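(* Let $\alpha,a',a,b\in\mathbb{R}$ and $n\in\mathbb{N}$, with $0\le a'<a<b$ and $0<\alpha\le1$. Let $f\in\mathcal{C}^\infty_\alpha([a,b],\mathbb{R})$. Then for every $h\in D_{(n+1)\alpha-1}$ with $h>0$, $$f(a+h)=\sum_{i=0}^n\frac{h^{i\alpha}}{\Gamma(i\alpha+1)}\,D_a^{i,\alpha}f(a)\quad\text{in }{}^\bullet\mathbb{R}.$$
   Context: Fermat reals. A little-oh polynomial is a function $x:\mathbb{R}_{\ge0}\to\mathbb{R}$ such that $x(t)=r+\sum_{i=1}^N a_i t^{\alpha_i}+o(t)$ as $t\to0^+$, for some $N\in\mathbb{N}$, $r,a_i\in\mathbb{R}$, $\alpha_i\in\mathbb{R}_{\ge0}$. Put $x\sim y$ iff $x(t)=y(t)+o(t)$ as $t\to0^+$. The ring ${}^\bullet\mathbb{R}$ of Fermat reals is the quotient of the ring of little-oh polynomials (pointwise operations) by $\sim$; it contains $\mathbb{R}$. For real $c>0$, $\mathrm{d}t_c$ denotes the class of $t\mapsto t^{1/c}$ (so $\mathrm{d}t_c=0$ iff $c<1$). Every $x\in{}^\bullet\mathbb{R}$ can be written uniquely as $x={}^\circ x+\sum_{j=1}^N b_j\,\mathrm{d}t_{\beta_j}$ with ${}^\circ x,b_j\in\mathbb{R}$, $b_j\ne0$, $\beta_1>\dots>\beta_N\ge1$, $N\ge0$ (the decomposition of $x$). The order is $\omega(x):=\beta_1$ if $N\ge1$, $\omega(x):=0$ if $x\in\mathbb{R}$. $D_c:=\{x\in{}^\bullet\mathbb{R}\mid{}^\circ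 x=0,\ \omega(x)<c+1\}$ for real $c$. For $h\ne0$ with ${}^\circ h=0$, $h>0$ means $b_1>0$. Powers. Put $u\ominus v:=(\frac1u-\frac1v)^{-1}$. For $h>0$ with ${}^\circ h=0$ and decomposition $h=\sum_{j=1}^N b_j\,\mathrm{d}t_{\beta_j}$, and $p>0$, $h^p:=b_1^p\,\mathrm{d}t_{\frac{\beta_1}p}\cdot\left(1+\sum_{j=2}^N\frac{b_j}{b_1}\,\mathrm{d}t_{\beta_j\ominus\beta_1}\right)^p$, where $(1+k)^p=1+\sum_{m\ge1}\binom pm k^m$ (a finite sum) for $k$ infinitesimal; $h^0:=1$. The value $f(a+h)\in{}^\bullet\mathbb{R}$ of the smooth function $f$ is the class of $t\mapsto f(a+h_t)$ (for small $t\ge0$), where $h_t:=\sum_{j=1}^N b_j t^{1/\beta_j}$ represents $h$. Fractional derivatives. For $\beta>0$, $J_a^\beta g(x):=\frac1{\Gamma(\beta)}\int_a^x(x-t)^{\beta-1}g(t)\,dt$ for $x>a$, and $J_a^0g:=g$. For $0<\alpha\le1$ the Caputo derivative is $D_a^\alpha g(x):=J_a^{1-\alpha}g'(x)$, i.e. $D_a^\alpha g(x)=\frac{1}{\Gamma(1-\alpha)}\int_a^x(x-t)^{-\alpha}g'(t)\,dt$ if $\alpha<1$ and $D_a^1g=g'$; its value at $x=a$ is understood by continuous extension. $D_a^{0,\alpha}f:=f$ and $D_a^{k,\alpha}:=D_a^\alpha\circ\dots\circ D_a^\alpha$ ($k$ times). $\mathcal{C}_0([a,b],\mathbb{R})$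 is the set of functions on $[a,b]$ of the form $x^pf_1(x)$ with $p>0$ and $f_1$ continuous on $[a,b]$. $\mathcal{C}^\infty_\alpha([a,b],\mathbb{R})$ is the set of $f\in\mathcal{C}^\infty([a,b],\mathbb{R})$ such that $D_a^{k,\alpha}f\in\mathcal{C}_0([a,b],\mathbb{R})$ for all $k\in\mathbb{N}$; this presupposes that all iterates are defined, i.e. each $D_a^{k,\alpha}f$ is differentiable on $(a,b]$ and the integrals defining the next iterate converge absolutely. *)

theory Defs
  imports "HOL-Analysis.Analysis" "HOL-Library.Landau_Symbols"
begin

section \<open>The ring of Fermat reals\<close>

text \<open>
  A list of pairs \<open>(a, e)\<close> encodes the finite sum of the terms \<open>a * t powr e\<close>.
  Functions on the nonnegative reals are represented by total functions on the reals;
  all notions below only depend on the germ at \<open>0\<close> from the right, so the quotient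
  is the same ring.
\<close>

definition powr_sum :: "(real \<times> real) list \<Rightarrow> real \<Rightarrow> real" where
  "powr_sum as t = (\<Sum>(a, e)\<leftarrow>as. a * t powr e)"

definition little_oh_poly :: "(real \<Rightarrow> real) \<Rightarrow> bool" where
  "little_oh_poly x \<longleftrightarrow>
     (\<exists>r as. (\<forall>(a, e)\<in>set as. e \<ge> 0) \<and>
             (\<lambda>t. x t - (r + powr_sum as t)) \<in> o[at_right 0](\<lambda>t. t))"

definition fermat_rel :: "(real \<Rightarrow> real) \<Rightarrow> (real \<Rightarrow> real) \<Rightarrow> bool" where
  "fermat_rel x y \<longleftrightarrow>
     little_oh_poly x \<and> little_oh_poly y \<and> (\<lambda>t. x t - y t) \<in> o[at_right 0](\<lambda>t. t)"

lemma powr_sum_Nil [simp]: "powr_sum [] t = 0"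
  by (simp add: powr_sum_def)

lemma powr_sum_Cons [simp]: "powr_sum ((a, e) # as) t = a * t powr e + powr_sum as t"
  by (simp add: powr_sum_def)

lemma powr_sum_append: "powr_sum (as @ bs) t = powr_sum as t + powr_sum bs t"
  by (simp add: powr_sum_def)

lemma eventually_at_right_0_pos: "eventually (\<lambda>t::real. 0 < t \<and> t < 1) (at_right 0)"
  using eventually_at_right_real[of 0 1] by simp

lemma little_oh_polyI:
  assumes "\<forall>(a, e)\<in>set as. e \<ge> 0"
    and "(\<lambda>t. x t - powr_sum as t) \<in> o[at_right 0](\<lambda>t. t)"
  shows "little_oh_poly x"
  unfolding little_oh_poly_def using assms by (intro exI[of _ 0] exI[of _ as]) auto

lemma little_oh_polyE:
  assumes "little_oh_poly x"
  obtains as where "\<forall>(a, e)\<in>set as. e \<ge> 0"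
    and "(\<lambda>t. x t - powr_sum as t) \<in> o[at_right 0](\<lambda>t. t)"
proof -
  obtain r as where as: "\<forall>(a, e)\<in>set as. e \<ge> 0"
    "(\<lambda>t. x t - (r + powr_sum as t)) \<in> o[at_right 0](\<lambda>t. t)"
    using assms unfolding little_oh_poly_def by blast
  have "\<forall>\<^sub>F t in at_right 0. x t - powr_sum ((r, 0) # as) t = x t - (r + powr_sum as t)"
    using eventually_at_right_0_pos by eventually_elim simp
  then have "(\<lambda>t. x t - powr_sum ((r, 0) # as) t) \<in> o[at_right 0](\<lambda>t. t)"
    using as(2) landau_o.small.in_cong by fast
  with as(1) show ?thesis by (intro that[of "(r, 0) # as"]) auto
qed

lemma powr_sum_mult:
  assumes "\<forall>(a, e)\<in>set as. e \<ge> 0" and "\<forall>(a, e)\<in>set bs. e \<ge> 0"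
  shows "\<exists>cs. (\<forall>(a, e)\<in>set cs. e \<ge> 0) \<and>
              (\<forall>t>0. powr_sum as t * powr_sum bs t = powr_sum cs t)"
  using assms(1)
proof (induction as)
  case Nil
  show ?case by (intro exI[of _ "[]"]) simp
next
  case (Cons p as)
  obtain a e where p: "p = (a, e)" by force
  with Cons.prems have e: "e \<ge> 0" by simp
  obtain cs where cs: "\<forall>(a, e)\<in>set cs. e \<ge> 0"
    "\<And>t. t > 0 \<Longrightarrow> powr_sum as t * powr_sum bs t = powr_sum cs t"
    using Cons by auto
  let ?ds = "map (\<lambda>(b, e'). (a * b, e + e')) bs"
  have "a * t powr e * powr_sum bs t = powr_sum ?ds t" if "t > 0" for t
    using that by (induction bs) (auto simp: algebra_simps powr_add)
  with cs(2) have "\<And>t. t > 0 \<Longrightarrow> powr_sum (p # as) t * powr_sum bs t = powr_sum (?ds @ cs) t"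
    by (simp add: p powr_sum_append algebra_simps)
  moreover have "\<forall>(a, e)\<in>set (?ds @ cs). e \<ge> 0"
    using cs(1) assms(2) e by fastforce
  ultimately show ?case by blast
qed

lemma powr_sum_bigo_1:
  assumes "\<forall>(a, e)\<in>set as. e \<ge> 0"
  shows "powr_sum as \<in> O[at_right 0](\<lambda>_. 1)"
  using assms
proof (induction as)
  case Nil
  then show ?case by (simp add: powr_sum_def)
next
  case (Cons p as)
  obtain a e where p: "p = (a, e)" by force
  with Cons.prems have e: "e \<ge> 0" by simp
  have "(\<lambda>t. a * t powr e) \<in> O[at_right 0](\<lambda>_. 1)"
  proof (rule bigoI[of _ "\<bar>a\<bar>"])
    show "\<forall>\<^sub>F t in at_right 0. norm (a * t powr e) \<le> \<bar>a\<bar> * norm (1::real)"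
      using eventually_at_right_0_pos
      by eventually_elim (use e in \<open>auto simp: abs_mult intro!: mult_left_le powr_le1\<close>)
  qed
  moreover have "powr_sum as \<in> O[at_right 0](\<lambda>_. 1)"
    using Cons by simp
  ultimately have "(\<lambda>t. a * t powr e + powr_sum as t) \<in> O[at_right 0](\<lambda>_. 1)"
    by (rule sum_in_bigo)
  then show ?case by (simp add: p)
qed

lemma little_oh_poly_bigo_1:
  assumes "little_oh_poly x"
  shows "x \<in> O[at_right 0](\<lambda>_. 1)"
proof -
  obtain as where as: "\<forall>(a, e)\<in>set as. e \<ge> 0"
    "(\<lambda>t. x t - powr_sum as t) \<in> o[at_right 0](\<lambda>t. t)"
    using assms by (rule little_oh_polyE)
  have id: "(\<lambda>t::real. t) \<in> O[at_right 0](\<lambda>_. 1)"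
  proof (rule bigoI[of _ 1])
    show "\<forall>\<^sub>F t in at_right 0. norm (t::real) \<le> 1 * norm (1::real)"
      using eventually_at_right_0_pos by eventually_elim simp
  qed
  have "(\<lambda>t. x t - powr_sum as t) \<in> O[at_right 0](\<lambda>_. 1)"
    using landau_o.small_imp_big[OF as(2)] id by (rule landau_o.big_trans)
  from sum_in_bigo(1)[OF this powr_sum_bigo_1[OF as(1)]] show ?thesis by simp
qed

lemma little_oh_poly_const: "little_oh_poly (\<lambda>_. c)"
  unfolding little_oh_poly_def by (intro exI[of _ c] exI[of _ "[]"]) simp

lemma little_oh_poly_powr: "e \<ge> 0 \<Longrightarrow> little_oh_poly (\<lambda>t. t powr e)"
  unfolding little_oh_poly_def by (intro exI[of _ 0] exI[of _ "[(1, e)]"]) simp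

lemma little_oh_poly_add:
  assumes "little_oh_poly x" and "little_oh_poly y"
  shows "little_oh_poly (\<lambda>t. x t + y t)"
proof -
  obtain as where as: "\<forall>(a, e)\<in>set as. e \<ge> 0"
    "(\<lambda>t. x t - powr_sum as t) \<in> o[at_right 0](\<lambda>t. t)"
    using assms(1) by (rule little_oh_polyE)
  obtain bs where bs: "\<forall>(a, e)\<in>set bs. e \<ge> 0"
    "(\<lambda>t. y t - powr_sum bs t) \<in> o[at_right 0](\<lambda>t. t)"
    using assms(2) by (rule little_oh_polyE)
  show ?thesis
  proof (rule little_oh_polyI[of "as @ bs"])
    show "\<forall>(a, e)\<in>set (as @ bs). e \<ge> 0" using as(1) bs(1) by auto
    show "(\<lambda>t. x t + y t - powr_sum (as @ bs) t) \<in> o[at_right 0](\<lambda>t. t)"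
      using sum_in_smallo(1)[OF as(2) bs(2)] by (simp add: powr_sum_append algebra_simps)
  qed
qed

lemma little_oh_poly_mult:
  assumes "little_oh_poly x" and "little_oh_poly y"
  shows "little_oh_poly (\<lambda>t. x t * y t)"
proof -
  obtain as where as: "\<forall>(a, e)\<in>set as. e \<ge> 0"
    "(\<lambda>t. x t - powr_sum as t) \<in> o[at_right 0](\<lambda>t. t)"
    using assms(1) by (rule little_oh_polyE)
  obtain bs where bs: "\<forall>(a, e)\<in>set bs. e \<ge> 0"
    "(\<lambda>t. y t - powr_sum bs t) \<in> o[at_right 0](\<lambda>t. t)"
    using assms(2) by (rule little_oh_polyE)
  obtain cs where cs: "\<forall>(a, e)\<in>set cs. e \<ge> 0"
    "\<And>t. t > 0 \<Longrightarrow> powr_sum as t * powr_sum bs t = powr_sum cs t"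
    using powr_sum_mult[OF as(1) bs(1)] by blast
  have 1: "(\<lambda>t. (x t - powr_sum as t) * y t) \<in> o[at_right 0](\<lambda>t. t)"
    using landau_o.small_big_mult[OF as(2) little_oh_poly_bigo_1[OF assms(2)]] by simp
  have 2: "(\<lambda>t. powr_sum as t * (y t - powr_sum bs t)) \<in> o[at_right 0](\<lambda>t. t)"
    using landau_o.big_small_mult[OF powr_sum_bigo_1[OF as(1)] bs(2)] by simp
  have "\<forall>\<^sub>F t in at_right 0. x t * y t - powr_sum cs t =
      (x t - powr_sum as t) * y t + powr_sum as t * (y t - powr_sum bs t)"
    using eventually_at_right_0_pos
    by eventually_elim (simp add: cs(2)[symmetric] algebra_simps)
  then have "(\<lambda>t. x t * y t - powr_sum cs t) \<in> o[at_right 0](\<lambda>t. t)"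
    using sum_in_smallo(1)[OF 1 2] landau_o.small.in_cong by fast
  with cs(1) show ?thesis by (rule little_oh_polyI)
qed

lemma little_oh_poly_uminus: "little_oh_poly x \<Longrightarrow> little_oh_poly (\<lambda>t. - x t)"
  using little_oh_poly_mult[OF little_oh_poly_const[of "-1"], of x] by simp

lemma fermat_rel_refl: "little_oh_poly x \<Longrightarrow> fermat_rel x x"
  by (simp add: fermat_rel_def)

lemma fermat_rel_sym: "fermat_rel x y \<Longrightarrow> fermat_rel y x"
  unfolding fermat_rel_def using landau_o.small.uminus_in_iff[of "\<lambda>t. x t - y t"] by simp

lemma fermat_rel_trans: "fermat_rel x y \<Longrightarrow> fermat_rel y z \<Longrightarrow> fermat_rel x z"
  unfolding fermat_rel_def
  using sum_in_smallo(1)[of "\<lambda>t. x t - y t" _ "\<lambda>t. t" "\<lambda>t. y t - z t"] by simp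

lemma fermat_rel_add:
  assumes "fermat_rel x x'" and "fermat_rel y y'"
  shows "fermat_rel (\<lambda>t. x t + y t) (\<lambda>t. x' t + y' t)"
  using assms sum_in_smallo(1)[of "\<lambda>t. x t - x' t" _ "\<lambda>t. t" "\<lambda>t. y t - y' t"]
  by (auto simp: fermat_rel_def algebra_simps intro: little_oh_poly_add)

lemma fermat_rel_mult:
  assumes "fermat_rel x x'" and "fermat_rel y y'"
  shows "fermat_rel (\<lambda>t. x t * y t) (\<lambda>t. x' t * y' t)"
proof -
  have "(\<lambda>t. (x t - x' t) * y t) \<in> o[at_right 0](\<lambda>t. t)"
    using assms landau_o.small_big_mult[of "\<lambda>t. x t - x' t" _ "\<lambda>t. t" y "\<lambda>_. 1"]
    by (simp add: fermat_rel_def little_oh_poly_bigo_1)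
  moreover have "(\<lambda>t. x' t * (y t - y' t)) \<in> o[at_right 0](\<lambda>t. t)"
    using assms landau_o.big_small_mult[of x' _ "\<lambda>_. 1" "\<lambda>t. y t - y' t" "\<lambda>t. t"]
    by (simp add: fermat_rel_def little_oh_poly_bigo_1)
  ultimately have "(\<lambda>t. (x t - x' t) * y t + x' t * (y t - y' t)) \<in> o[at_right 0](\<lambda>t. t)"
    by (rule sum_in_smallo)
  moreover have "(\<lambda>t. (x t - x' t) * y t + x' t * (y t - y' t)) = (\<lambda>t. x t * y t - x' t * y' t)"
    by (auto simp: algebra_simps)
  ultimately show ?thesis
    using assms by (simp add: fermat_rel_def little_oh_poly_mult)
qed

lemma fermat_rel_uminus: "fermat_rel x y \<Longrightarrow> fermat_rel (\<lambda>t. - x t) (\<lambda>t. - y t)"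
  using fermat_rel_mult[OF fermat_rel_refl[OF little_oh_poly_const[of "-1"]], of x y] by simp

lemma part_equivp_fermat_rel: "part_equivp fermat_rel"
  by (intro part_equivpI sympI transpI exI[of _ "\<lambda>_. 0"])
     (auto intro: fermat_rel_refl little_oh_poly_const fermat_rel_sym fermat_rel_trans)

quotient_type fermat = "real \<Rightarrow> real" / partial: fermat_rel
  morphisms rep_fermat Fermat
  by (rule part_equivp_fermat_rel)

instantiation fermat :: "{comm_ring_1, real_algebra_1}"
begin

lift_definition zero_fermat :: fermat is "\<lambda>_. 0"
  by (intro fermat_rel_refl little_oh_poly_const)

lift_definition one_fermat :: fermat is "\<lambda>_. 1"
  by (intro fermat_rel_refl little_oh_poly_const)

lift_definition plus_fermat :: "fermat \<Rightarrow> fermat \<Rightarrow> fermat" is "\<lambda>x y t. x t + y t"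
  by (rule fermat_rel_add)

lift_definition uminus_fermat :: "fermat \<Rightarrow> fermat" is "\<lambda>x t. - x t"
  by (rule fermat_rel_uminus)

lift_definition minus_fermat :: "fermat \<Rightarrow> fermat \<Rightarrow> fermat" is "\<lambda>x y t. x t - y t"
  using fermat_rel_add[OF _ fermat_rel_uminus] by simp

lift_definition times_fermat :: "fermat \<Rightarrow> fermat \<Rightarrow> fermat" is "\<lambda>x y t. x t * y t"
  by (rule fermat_rel_mult)

lift_definition scaleR_fermat :: "real \<Rightarrow> fermat \<Rightarrow> fermat" is "\<lambda>r x t. r * x t"
  by (intro fermat_rel_mult fermat_rel_refl little_oh_poly_const)

instance
proof
  fix x y z :: fermat and r s :: real
  show "x * y * z = x * (y * z)" by transfer (auto simp: mult_ac intro: fermat_rel_mult)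
  show "x * y = y * x" by transfer (auto simp: mult_ac intro: fermat_rel_mult)
  show "1 * x = x" by transfer simp
  show "x + y + z = x + (y + z)" by transfer (auto simp: add_ac intro: fermat_rel_add)
  show "x + y = y + x" by transfer (auto simp: add_ac intro: fermat_rel_add)
  show "0 + x = x" by transfer simp
  show "- x + x = 0" by transfer (simp add: fermat_rel_refl little_oh_poly_const)
  show "x - y = x + - y"
    by transfer (simp add: fermat_rel_add[OF _ fermat_rel_uminus, of _ _ _ _, simplified])
  show "(x + y) * z = x * z + y * z"
    by transfer (simp add: distrib_right fermat_rel_add fermat_rel_mult)
  show "x * (y + z) = x * y + x * z"
    by transfer (simp add: distrib_left fermat_rel_add fermat_rel_mult)
  show "x * 1 = x" by transfer simp
  show "(0::fermat) \<noteq> 1"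
  proof transfer
    have "\<not> (\<lambda>_. - 1 :: real) \<in> o[at_right 0](\<lambda>t. t)"
    proof
      assume "(\<lambda>_. - 1 :: real) \<in> o[at_right 0](\<lambda>t. t)"
      then have "\<forall>\<^sub>F t in at_right (0::real). norm (-1 :: real) \<le> 1 * norm t"
        by (rule landau_o.smallD) simp
      with eventually_at_right_0_pos have "\<forall>\<^sub>F t in at_right (0::real). False"
        by eventually_elim simp
      then show False by simp
    qed
    then show "\<not> fermat_rel (\<lambda>_. 0) (\<lambda>_. 1)" by (simp add: fermat_rel_def)
  qed
  show "r *\<^sub>R (x + y) = r *\<^sub>R x + r *\<^sub>R y"
    by transfer (simp add: distrib_left fermat_rel_add fermat_rel_mult fermat_rel_refl little_oh_poly_const)
  show "(r + s) *\<^sub>R x = r *\<^sub>R x + s *\<^sub>R x"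
    by transfer (simp add: distrib_right fermat_rel_add fermat_rel_mult fermat_rel_refl little_oh_poly_const)
  show "r *\<^sub>R s *\<^sub>R x = (r * s) *\<^sub>R x"
    by transfer (simp add: mult_ac fermat_rel_mult fermat_rel_refl little_oh_poly_const)
  show "1 *\<^sub>R x = x" by transfer simp
  show "r *\<^sub>R x * y = r *\<^sub>R (x * y)"
    by transfer (simp add: mult_ac fermat_rel_mult fermat_rel_refl little_oh_poly_const)
  show "x * r *\<^sub>R y = r *\<^sub>R (x * y)"
    by transfer (simp add: mult_ac fermat_rel_mult fermat_rel_refl little_oh_poly_const)
qed

end

lemma of_real_fermat: "of_real r = Fermat (\<lambda>_. r)"
  unfolding of_real_def scaleR_fermat.abs_eq one_fermat_def
  by (simp add: scaleR_fermat.abs_eq fermat_rel_refl little_oh_poly_const)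


section \<open>Decomposition, order and infinitesimals\<close>

definition dt :: "real \<Rightarrow> fermat" where
  "dt c = Fermat (\<lambda>t. t powr (1 / c))"

text \<open>
  The list in a decomposition consists of the pairs \<open>(b\<^sub>j, \<beta>\<^sub>j)\<close>, by strictly decreasing \<open>\<beta>\<^sub>j\<close>.
\<close>

definition is_decomposition :: "fermat \<Rightarrow> real \<times> (real \<times> real) list \<Rightarrow> bool" where
  "is_decomposition x = (\<lambda>(r, bs).
     sorted_wrt (\<lambda>(b, \<beta>) (b', \<beta>'). \<beta> > \<beta>') bs \<and>
     (\<forall>(b, \<beta>)\<in>set bs. b \<noteq> 0 \<and> \<beta> \<ge> 1) \<and>
     x = of_real r + (\<Sum>(b, \<beta>)\<leftarrow>bs. b *\<^sub>R dt \<beta>))"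

definition decomposition :: "fermat \<Rightarrow> real \<times> (real \<times> real) list" where
  "decomposition x = (THE d. is_decomposition x d)"

definition std_part :: "fermat \<Rightarrow> real" where
  "std_part x = fst (decomposition x)"

definition inf_terms :: "fermat \<Rightarrow> (real \<times> real) list" where
  "inf_terms x = snd (decomposition x)"

definition fermat_order :: "fermat \<Rightarrow> real" where
  "fermat_order x = (if inf_terms x = [] then 0 else snd (hd (inf_terms x)))"

definition D_inf :: "real \<Rightarrow> fermat set" where
  "D_inf c = {x. std_part x = 0 \<and> fermat_order x < c + 1}"

definition pos_infinitesimal :: "fermat \<Rightarrow> bool" where
  "pos_infinitesimal h \<longleftrightarrow> h \<noteq> 0 \<and> std_part h = 0 \<and> fst (hd (inf_terms h)) > 0"


section \<open>Powers and values of functions\<close>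

definition ominus :: "real \<Rightarrow> real \<Rightarrow> real" where
  "ominus u v = inverse (1 / u - 1 / v)"

text \<open>
  The index set is finite for infinitesimal \<open>k\<close>, since such \<open>k\<close> are nilpotent.
\<close>

definition one_plus_power :: "fermat \<Rightarrow> real \<Rightarrow> fermat" where
  "one_plus_power k p = 1 + (\<Sum>m | m \<ge> 1 \<and> k ^ m \<noteq> 0. (p gchoose m) *\<^sub>R k ^ m)"

definition fermat_power :: "fermat \<Rightarrow> real \<Rightarrow> fermat" where
  "fermat_power h p =
     (if p = 0 then 1
      else let (b1, \<beta>1) = hd (inf_terms h) in
        (b1 powr p) *\<^sub>R dt (\<beta>1 / p) *
        one_plus_power (\<Sum>(b, \<beta>)\<leftarrow>tl (inf_terms h). (b / b1) *\<^sub>R dt (ominus \<beta> \<beta>1)) p)"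

definition fermat_value :: "(real \<Rightarrow> real) \<Rightarrow> real \<Rightarrow> fermat \<Rightarrow> fermat" where
  "fermat_value f a h = Fermat (\<lambda>t. f (a + (\<Sum>(b, \<beta>)\<leftarrow>inf_terms h. b * t powr (1 / \<beta>))))"


section \<open>Caputo derivatives\<close>

text \<open>
  Functions on \<open>{a..b}\<close> are represented by total functions whose values outside of \<open>{a..b}\<close>
  are irrelevant; derivatives are therefore taken within \<open>{a..b}\<close>.
\<close>

definition RL_integral :: "real \<Rightarrow> real \<Rightarrow> (real \<Rightarrow> real) \<Rightarrow> real \<Rightarrow> real" where
  "RL_integral a \<beta> g x =
     (if \<beta> = 0 then g x
      else 1 / Gamma \<beta> * integral {a..x} (\<lambda>t. (x - t) powr (\<beta> - 1) * g t))"

definition deriv_within :: "real set \<Rightarrow> (real \<Rightarrow> real) \<Rightarrow> real \<Rightarrow> real" where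
  "deriv_within S g t = vector_derivative g (at t within S)"

text \<open>
  The value at \<open>a\<close> is the continuous extension. Should the limit not exist, it is arbitrary,
  and the function is then not continuous at \<open>a\<close>.
\<close>

definition caputo :: "real \<Rightarrow> real \<Rightarrow> real \<Rightarrow> (real \<Rightarrow> real) \<Rightarrow> real \<Rightarrow> real" where
  "caputo a b \<alpha> g x =
     (let D = RL_integral a (1 - \<alpha>) (deriv_within {a..b} g)
      in if x = a then Lim (at_right a) D else D x)"

definition caputo_iter :: "real \<Rightarrow> real \<Rightarrow> real \<Rightarrow> nat \<Rightarrow> (real \<Rightarrow> real) \<Rightarrow> real \<Rightarrow> real" where
  "caputo_iter a b \<alpha> k = caputo a b \<alpha> ^^ k"

definition caputo_defined :: "real \<Rightarrow> real \<Rightarrow> real \<Rightarrow> (real \<Rightarrow> real) \<Rightarrow> bool" where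
  "caputo_defined a b \<alpha> g \<longleftrightarrow>
     (\<forall>x\<in>{a<..b}. g differentiable (at x within {a..b})) \<and>
     (\<alpha> < 1 \<longrightarrow> (\<forall>x\<in>{a<..b}.
        (\<lambda>t. (x - t) powr (- \<alpha>) * deriv_within {a..b} g t) absolutely_integrable_on {a..x}))"

definition C_0 :: "real \<Rightarrow> real \<Rightarrow> (real \<Rightarrow> real) set" where
  "C_0 a b = {g. \<exists>p>0. \<exists>f1. continuous_on {a..b} f1 \<and> (\<forall>x\<in>{a..b}. g x = x powr p * f1 x)}"

definition C_inf :: "real \<Rightarrow> real \<Rightarrow> (real \<Rightarrow> real) set" where
  "C_inf a b = {f. \<exists>F. (\<forall>x\<in>{a..b}. F 0 x = f x) \<and>
     (\<forall>k. \<forall>x\<in>{a..b}. (F k has_real_derivative F (Suc k) x) (at x within {a..b}))}"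

definition C_inf_alpha :: "real \<Rightarrow> real \<Rightarrow> real \<Rightarrow> (real \<Rightarrow> real) set" where
  "C_inf_alpha \<alpha> a b = {f \<in> C_inf a b.
     \<forall>k. caputo_defined a b \<alpha> (caputo_iter a b \<alpha> k f) \<and> caputo_iter a b \<alpha> k f \<in> C_0 a b}"

end

theory Submission
  imports Defs
begin

text \<open>
  Fubini and the Beta integral give Abel's inversion
  \<open>J\<^sup>\<alpha> (D\<^sup>\<alpha> g) = g - g(a)\<close>. Applying it repeatedly to the iterates
  \<open>g\<^sub>k = (D\<^sup>\<alpha>)\<^sup>k f\<close> yields the fractional Taylor formula for \<open>f(a + x)\<close> with remainder
  \<open>O(x powr ((n + 1) \<alpha>))\<close>, since the \<open>g\<^sub>k\<close> are bounded.
  If \<open>h\<close> has order less than \<open>(n + 1) \<alpha>\<close>, its representative is \<open>O(t powr q)\<close> with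
  \<open>q > 1 / ((n + 1) \<alpha>)\<close>, so the remainder is \<open>o(t)\<close>. The algebraically defined power of \<open>h\<close>
  is the class of the pointwise power of this representative, because the binomial
  series may be truncated modulo \<open>o(t)\<close>.
\<close>

section \<open>Fractional Taylor formula\<close>

text \<open>The substitution \<open>t = (s - c) / (x - c)\<close> reduces this to Euler's Beta
  integral. It computes the fractional integral of a power: with \<open>p + q = 1\<close> it gives
  the constant in Abel's inversion, and with \<open>p = \<alpha>\<close> it integrates the terms of
  the Taylor sum.\<close>

lemma has_integral_Beta_affine:
  fixes p q c x :: real
  assumes "p > 0" "q > 0" "c < x"
  shows "((\<lambda>s. (x - s) powr (p - 1) * (s - c) powr (q - 1)) has_integral
          Gamma p * Gamma q / Gamma (p + q) * (x - c) powr (p + q - 1)) {c<..<x}"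
proof -
  define d where "d = x - c"
  have d: "d > 0" using assms by (simp add: d_def)
  have I: "((\<lambda>t. t powr (q - 1) * (1 - t) powr (p - 1)) has_integral Beta q p) (cbox 0 1)"
    using has_integral_Beta_real[OF assms(2,1)] by simp
  \<comment> \<open>This identifies the right endpoint of the interval that the affine map
    \<open>s / d - c / d\<close> sends onto the unit interval.\<close>
  have e: "d * (1 + c / d) = x"
    using d by (simp add: distrib_left) (simp add: d_def)
  have "((\<lambda>s. ((s - c) / d) powr (q - 1) * (1 - (s - c) / d) powr (p - 1)) has_integral
           Beta q p * d) {c..x}"
    using has_integral_affinity'[OF I, of "1/d" "- c/d"] d e
    by (simp add: diff_divide_distrib mult.commute)
  \<comment> \<open>This factor clears the denominators \<open>d\<close> of both powers; the
    Jacobian contributes one more \<open>d\<close>, hence the final exponent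
    \<open>p + q - 1\<close>.\<close>
  from has_integral_mult_right[OF this, of "d powr (p + q - 2)"]
  have "((\<lambda>s. d powr (p + q - 2) * (((s - c) / d) powr (q - 1) * (1 - (s - c) / d) powr (p - 1)))
     has_integral d powr (p + q - 2) * (Beta q p * d)) {c<..<x}"
    by (simp only: has_integral_Icc_iff_Ioo)
  also have "?this \<longleftrightarrow> ((\<lambda>s. (x - s) powr (p - 1) * (s - c) powr (q - 1)) has_integral
     d powr (p + q - 2) * (Beta q p * d)) {c<..<x}"
  proof (rule has_integral_cong)
    fix s assume s: "s \<in> {c<..<x}"
    have e: "1 - (s - c) / d = (x - s) / d"
      using d by (simp add: d_def field_simps)
    have "d powr (p + q - 2) = d powr (q - 1) * d powr (p - 1)"
      by (simp add: algebra_simps flip: powr_add)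
    then show "d powr (p + q - 2) * (((s - c) / d) powr (q - 1) * (1 - (s - c) / d) powr (p - 1)) =
        (x - s) powr (p - 1) * (s - c) powr (q - 1)"
      unfolding e using s d by (simp add: powr_divide)
  qed
  also have "d powr (p + q - 2) * (Beta q p * d) = Beta q p * (d powr (p + q - 2) * d powr 1)"
    using d by simp
  also have "d powr (p + q - 2) * d powr 1 = d powr (p + q - 1)"
    by (subst powr_add[symmetric]) (simp add: algebra_simps)
  finally show ?thesis
    by (simp add: Beta_def d_def mult_ac add_ac)
qed

text \<open>Over the triangle \<open>a < t < s < x\<close> the order of integration is interchanged.
  The inner integral in \<open>s\<close> is then a Beta integral with exponents summing to 1, so it
  does not depend on \<open>t\<close> and comes out as a constant.\<close>

lemma Abel_inversion:
  fixes \<alpha> a x :: real and v :: "real \<Rightarrow> real"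
  assumes \<alpha>: "0 < \<alpha>" "\<alpha> < 1" and v: "integrable lborel v"
  shows "((\<lambda>s. (x - s) powr (\<alpha> - 1) * integral {a<..<s} (\<lambda>t. (s - t) powr (- \<alpha>) * v t))
          has_integral Gamma \<alpha> * Gamma (1 - \<alpha>) * integral {a<..<x} v) {a<..<x}"
proof -
  have [measurable]: "v \<in> borel_measurable borel"
    using v by auto
  define B where "B = Gamma \<alpha> * Gamma (1 - \<alpha>)"
  have B: "B > 0" using \<alpha> by (simp add: B_def Gamma_real_pos)
  \<comment> \<open>The triangle is built into the integrand by extension with 0, so that Fubini
    applies on the whole plane. \<open>K\<close> below is the kernel without
    \<open>v\<close>.\<close>
  define F where "F = (\<lambda>t s. (if a < t \<and> t < s \<and> s < x
     then (x - s) powr (\<alpha> - 1) * (s - t) powr (- \<alpha>) else 0) * v t)"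
  define K where "K = (\<lambda>t s. if t < s \<and> s < x then (x - s) powr (\<alpha> - 1) * (s - t) powr (- \<alpha>) else 0)"
  have K: "integrable lborel (K t)" "integral\<^sup>L lborel (K t) = B" if "t < x" for t
  proof -
    have "((\<lambda>s. (x - s) powr (\<alpha> - 1) * (s - t) powr (- \<alpha>)) has_integral B) {t<..<x}"
      using has_integral_Beta_affine[of \<alpha> "1 - \<alpha>" t x] \<alpha> that by (simp add: B_def)
    then have "((\<lambda>s. if s \<in> {t<..<x} then (x - s) powr (\<alpha> - 1) * (s - t) powr (- \<alpha>) else 0) has_integral B) UNIV"
      by (simp only: has_integral_restrict_UNIV)
    also have "(\<lambda>s. if s \<in> {t<..<x} then (x - s) powr (\<alpha> - 1) * (s - t) powr (- \<alpha>) else 0) = K t"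
      by (auto simp: K_def)
    \<comment> \<open>As \<open>K t\<close> is nonnegative and Borel measurable, its gauge integral
      is also its Lebesgue integral.\<close>
    finally have "integral\<^sup>N lborel (K t) = B"
      by (intro nn_integral_has_integral_lborel) (auto simp: K_def)
    then have "has_bochner_integral lborel (K t) B"
      using B by (intro has_bochner_integral_nn_integral) (auto simp: K_def)
    then show "integrable lborel (K t)" "integral\<^sup>L lborel (K t) = B"
      by (auto simp: has_bochner_integral_iff)
  qed
  have F_eq: "F t s = (if a < t \<and> t < x then v t * K t s else 0)" for t s
    by (auto simp: F_def K_def)
  have norm_F_eq: "norm (F t s) = (if a < t \<and> t < x then \<bar>v t\<bar> * K t s else 0)" for t s
    by (auto simp: F_def K_def abs_mult)
  have int_F: "integral\<^sup>L lborel (F t) = B * (indicator {a<..<x} t * v t)" for t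
    using K[of t] unfolding F_eq by (auto simp: indicator_def)
  have v_set: "integrable lborel (\<lambda>t. indicator {a<..<x} t * w t)" if "integrable lborel w"
    for w :: "real \<Rightarrow> real"
    using integrable_real_mult_indicator[OF _ that, of "{a<..<x}"] by (simp add: mult.commute)
  have F_int: "integrable (lborel \<Otimes>\<^sub>M lborel) (case_prod F)"
  proof (rule lborel_pair.Fubini_integrable)
    show "case_prod F \<in> borel_measurable (lborel \<Otimes>\<^sub>M lborel)"
      unfolding F_def by measurable
    have "integral\<^sup>L lborel (\<lambda>s. norm (F t s)) = B * (indicator {a<..<x} t * \<bar>v t\<bar>)" for t
      using K[of t] unfolding norm_F_eq by (auto simp: indicator_def)
    then show "integrable lborel (\<lambda>t. LINT s|lborel. norm (case (t, s) of (t, s) \<Rightarrow> F t s))"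
      using v_set[OF integrable_abs[OF v]] by simp
    show "AE t in lborel. integrable lborel (\<lambda>s. case (t, s) of (t, s) \<Rightarrow> F t s)"
    proof (rule AE_I2)
      show "integrable lborel (\<lambda>s. case (t, s) of (t, s) \<Rightarrow> F t s)" for t
      proof (cases "a < t \<and> t < x")
        case True
        then have "(\<lambda>s. F t s) = (\<lambda>s. v t * K t s)" by (auto simp: F_eq)
          with K(1)[of t] True show ?thesis by simp
      next
        case False
        then have "(\<lambda>s. F t s) = (\<lambda>s. 0)" by (auto simp: F_eq)
        then show ?thesis by simp
      qed
    qed
  qed
  define \<Phi> where "\<Phi> = (\<lambda>s. LINT t|lborel. F t s)"
  have \<Phi>_int: "integrable lborel \<Phi>"
    unfolding \<Phi>_def by (rule lborel_pair.integrable_snd[OF F_int])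
  have "integral\<^sup>L lborel \<Phi> = (LINT t|lborel. LINT s|lborel. F t s)"
    unfolding \<Phi>_def by (rule lborel_pair.Fubini_integral[OF F_int])
  also have "\<dots> = B * (LINT t|lborel. indicator {a<..<x} t * v t)"
    by (simp add: int_F)
  also have "(LINT t|lborel. indicator {a<..<x} t * v t) = integral {a<..<x} v"
    using set_borel_integral_eq_integral(2)[of "{a<..<x}" v] v_set[OF v]
    by (simp add: set_integrable_def set_lebesgue_integral_def)
  finally have \<Phi>: "(\<Phi> has_integral B * integral {a<..<x} v) UNIV"
    using has_integral_integral_lborel[OF \<Phi>_int]
    by (simp only:)
  \<comment> \<open>Fubini makes \<open>F t s\<close> integrable in \<open>t\<close> only for almost
    every \<open>s\<close>; an identity off a null set is enough to transfer
    \<open>has_integral\<close>.\<close>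
  have "AE s in lborel. \<Phi> s = (if s \<in> {a<..<x} then (x - s) powr (\<alpha> - 1) *
      integral {a<..<s} (\<lambda>t. (s - t) powr (- \<alpha>) * v t) else 0)"
    using lborel_pair.AE_integrable_snd[OF F_int]
  proof eventually_elim
    case (elim s)
    show ?case
    proof (cases "s \<in> {a<..<x}")
      case False
      then have "F t s = 0" for t by (auto simp: F_def)
      then have "\<Phi> s = 0" by (simp add: \<Phi>_def)
      with False show ?thesis by (simp only: if_False)
    next
      case True
      have eq: "F t s = (x - s) powr (\<alpha> - 1) * (if t \<in> {a<..<s} then (s - t) powr (- \<alpha>) * v t else 0)" for t
        using True by (auto simp: F_def)
      have "((\<lambda>t. F t s) has_integral \<Phi> s) UNIV"
        using has_integral_integral_lborel[OF elim] by (simp add: \<Phi>_def)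
      then have "integral UNIV (\<lambda>t. F t s) = \<Phi> s"
        by (rule integral_unique)
      also have "integral UNIV (\<lambda>t. F t s) = (x - s) powr (\<alpha> - 1) *
          integral UNIV (\<lambda>t. if t \<in> {a<..<s} then (s - t) powr (- \<alpha>) * v t else 0)"
        unfolding eq by (rule integral_mult_right)
      also have "integral UNIV (\<lambda>t. if t \<in> {a<..<s} then (s - t) powr (- \<alpha>) * v t else 0) =
          integral {a<..<s} (\<lambda>t. (s - t) powr (- \<alpha>) * v t)"
        by (rule integral_restrict_UNIV)
      finally show ?thesis using True by (simp only: if_True)
    qed
  qed
  then have "(\<Phi> has_integral B * integral {a<..<x} v) UNIV \<longleftrightarrow>
    ((\<lambda>s. if s \<in> {a<..<x} then (x - s) powr (\<alpha> - 1) *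
      integral {a<..<s} (\<lambda>t. (s - t) powr (- \<alpha>) * v t) else 0) has_integral B * integral {a<..<x} v) UNIV"
    by (intro has_integral_AE) (erule eventually_mono, rule impI)
  also have "\<dots> \<longleftrightarrow> ?thesis"
    unfolding has_integral_restrict_UNIV B_def ..
  finally show ?thesis using \<Phi> by (rule iffD1)
qed

lemma integral_AE_cong:
  fixes f g :: "real \<Rightarrow> real"
  assumes "AE x in lborel. x \<in> S \<longrightarrow> f x = g x"
  shows "integral S f = integral S g"
  unfolding integral_def integrable_on_def has_integral_AE[OF assms] ..

text \<open>Up to the factor \<open>Gamma \<alpha>\<close> this is \<open>J\<^sup>\<alpha>
  (J\<^sup>1\<^sup>-\<^sup>\<alpha> g') = g - g(a)\<close>: Abel's inversion for
  \<open>v = g'\<close> followed by the fundamental theorem of calculus. For \<alpha> < 1 the work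
  lies in replacing \<open>g'\<close> by an integrable Borel function.\<close>

lemma caputo_inversion:
  fixes \<alpha> a b :: real
  assumes ab: "a < b" and \<alpha>: "0 < \<alpha>" "\<alpha> \<le> 1"
    and def: "caputo_defined a b \<alpha> g" and cont: "continuous_on {a..b} g" and x: "x \<in> {a<..b}"
  shows "((\<lambda>s. (x - s) powr (\<alpha> - 1) * caputo a b \<alpha> g s) has_integral Gamma \<alpha> * (g x - g a)) {a<..<x}"
proof -
  define g' where "g' = deriv_within {a..b} g"
  \<comment> \<open>Differentiability is available on \<open>{a<..b}\<close> only, hence the
    interior form of the fundamental theorem, with continuity of \<open>g\<close> at the
    endpoints.\<close>
  have "(g has_vector_derivative g' t) (at t)" if "t \<in> {a<..<b}" for t
    using def that vector_derivative_works[of g "at t"]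
    by (auto simp: caputo_defined_def g'_def deriv_within_def at_within_Icc_at differentiable_def
        dest!: bspec[of _ _ t])
  then have "(g' has_integral (g x - g a)) {a..x}"
    using x by (intro fundamental_theorem_of_calculus_interior continuous_on_subset[OF cont]) auto
  then have FTC: "(g' has_integral (g x - g a)) {a<..<x}"
    by (simp only: has_integral_Icc_iff_Ioo)
  show ?thesis
  proof (cases "\<alpha> = 1")
    case True
    have "((\<lambda>s. (x - s) powr (\<alpha> - 1) * caputo a b \<alpha> g s) has_integral (g x - g a)) {a<..<x} \<longleftrightarrow>
        (g' has_integral (g x - g a)) {a<..<x}"
      by (rule has_integral_cong) (simp add: True caputo_def RL_integral_def g'_def)
    with FTC True show ?thesis by simp
  next
    case False
    with \<alpha> have \<alpha>: "0 < \<alpha>" "\<alpha> < 1" by auto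
    \<comment> \<open>Absolute convergence of the Caputo integral at \<open>x = b\<close>.
      Multiplying by \<open>(b - t) powr \<alpha>\<close>, which is at most
      \<open>(b - a) powr \<alpha>\<close>, removes the kernel, so \<open>g'\<close> itself agrees
      almost everywhere on \<open>{a<..<b}\<close> with the integrable \<open>v\<close>
      below.\<close>
    define w where "w = (\<lambda>t. indicator {a..b} t * ((b - t) powr (- \<alpha>) * g' t))"
    have w: "integrable lebesgue w"
      using def ab \<alpha> by (auto simp: caputo_defined_def set_integrable_def w_def g'_def)
    \<comment> \<open>\<open>w\<close> is only Lebesgue measurable; the product measurability
      required by Fubini is checked for a Borel representative.\<close>
    then obtain w' where w'_meas [measurable]: "w' \<in> borel_measurable borel"
      and w'_eq: "AE t in lborel. w t = w' t"
      using completion_ex_borel_measurable_real[of w lborel] by auto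
    have "integrable lebesgue w'"
    proof (rule integrable_cong_AE_imp[OF w])
      show "w' \<in> borel_measurable lebesgue"
        by (rule measurable_completion) simp
      show "AE t in lebesgue. w t = w' t"
        using AE_completion[OF w'_eq] .
    qed
    then have w'_int: "integrable lborel w'"
      by (simp add: integrable_completion)
    define v where "v = (\<lambda>t. if a < t \<and> t < b then (b - t) powr \<alpha> * w' t else 0)"
    have v_int: "integrable lborel v"
    proof (rule Bochner_Integration.integrable_bound)
      show "integrable lborel (\<lambda>t. (b - a) powr \<alpha> * w' t)"
        using w'_int by simp
      show "v \<in> borel_measurable lborel"
        unfolding v_def by measurable
      show "AE t in lborel. norm (v t) \<le> norm ((b - a) powr \<alpha> * w' t)"
        using \<alpha> by (intro AE_I2) (auto simp: v_def abs_mult intro!: mult_right_mono powr_mono2)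
    qed
    have v_eq: "AE t in lborel. t \<in> {a<..<b} \<longrightarrow> v t = g' t"
      using w'_eq
      by eventually_elim (auto simp: v_def w_def indicator_def powr_minus field_simps)
    \<comment> \<open>For \<open>s > a\<close> the Caputo derivative is given by its integral and
      not by the limit at \<open>a\<close>.\<close>
    have caputo_eq: "caputo a b \<alpha> g s =
        1 / Gamma (1 - \<alpha>) * integral {a<..<s} (\<lambda>t. (s - t) powr (- \<alpha>) * v t)"
      if s: "s \<in> {a<..<x}" for s
    proof -
      have "integral {a<..<s} (\<lambda>t. (s - t) powr (- \<alpha>) * v t) =
          integral {a<..<s} (\<lambda>t. (s - t) powr (- \<alpha>) * g' t)"
      proof (rule integral_AE_cong)
        show "AE t in lborel. t \<in> {a<..<s} \<longrightarrow> (s - t) powr (- \<alpha>) * v t = (s - t) powr (- \<alpha>) * g' t"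
          using v_eq by eventually_elim (use s x in auto)
      qed
      also have "\<dots> = integral {a..s} (\<lambda>t. (s - t) powr (- \<alpha>) * g' t)"
        by (rule integral_open_interval_real[symmetric])
      finally show ?thesis
        using s \<alpha> by (simp add: caputo_def RL_integral_def g'_def)
    qed
    have "integral {a<..<x} v = integral {a<..<x} g'"
      by (rule integral_AE_cong) (use v_eq x in \<open>auto elim: eventually_mono\<close>)
    also have "\<dots> = g x - g a"
      using FTC by (rule integral_unique)
    finally have "((\<lambda>s. 1 / Gamma (1 - \<alpha>) * ((x - s) powr (\<alpha> - 1) * integral {a<..<s} (\<lambda>t. (s - t) powr (- \<alpha>) * v t)))
          has_integral 1 / Gamma (1 - \<alpha>) * (Gamma \<alpha> * Gamma (1 - \<alpha>) * (g x - g a))) {a<..<x}"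
      using Abel_inversion[OF \<alpha> v_int, of x a] by (intro has_integral_mult_right) simp
    also have "?this \<longleftrightarrow> ((\<lambda>s. (x - s) powr (\<alpha> - 1) * caputo a b \<alpha> g s) has_integral
        1 / Gamma (1 - \<alpha>) * (Gamma \<alpha> * Gamma (1 - \<alpha>) * (g x - g a))) {a<..<x}"
      by (rule has_integral_cong) (simp add: caputo_eq)
    also have "1 / Gamma (1 - \<alpha>) * (Gamma \<alpha> * Gamma (1 - \<alpha>) * (g x - g a)) = Gamma \<alpha> * (g x - g a)"
      using Gamma_real_pos[of "1 - \<alpha>"] \<alpha> by (simp add: less_imp_neq[symmetric])
    finally show ?thesis .
  qed
qed

section \<open>The Taylor estimate for a chain of fractional derivatives\<close>

text \<open>The induction on \<open>m\<close> runs for all \<open>k\<close> at once: integrating the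
  expansion of \<open>g (Suc k)\<close> with \<open>m\<close> terms against the kernel yields that
  of \<open>g k\<close> with \<open>m + 1\<close> terms, as \<open>inv\<close> supplies
  \<open>g k x - g k a\<close>. The base case is boundedness of a continuous function on a compact
  interval.\<close>

lemma fractional_Taylor_bound:
  fixes g :: "nat \<Rightarrow> real \<Rightarrow> real" and a b \<alpha> :: real
  assumes ab: "a < b" and \<alpha>: "0 < \<alpha>"
    and cont: "\<And>k. continuous_on {a..b} (g k)"
    and inv: "\<And>k x. x \<in> {a<..b} \<Longrightarrow> ((\<lambda>s. (x - s) powr (\<alpha> - 1) * g (Suc k) s)
          has_integral Gamma \<alpha> * (g k x - g k a)) {a<..<x}"
  shows "\<exists>C. \<forall>x\<in>{a<..b}.
     \<bar>g k x - (\<Sum>i<m. g (k + i) a / Gamma (real i * \<alpha> + 1) * (x - a) powr (real i * \<alpha>))\<bar>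
       \<le> C * (x - a) powr (real m * \<alpha>)"
proof (induction m arbitrary: k)
  case 0
  have "bounded (g k ` {a..b})"
    by (intro compact_imp_bounded compact_continuous_image cont) simp
  then obtain C where "\<forall>x\<in>{a..b}. \<bar>g k x\<bar> \<le> C"
    by (auto simp: bounded_iff)
  then show ?case by (intro exI[of _ C]) auto
next
  case (Suc m)
  define S where "S = (\<lambda>s. \<Sum>i<m. g (Suc k + i) a / Gamma (real i * \<alpha> + 1) * (s - a) powr (real i * \<alpha>))"
  obtain C where C: "\<And>s. s \<in> {a<..b} \<Longrightarrow> \<bar>g (Suc k) s - S s\<bar> \<le> C * (s - a) powr (real m * \<alpha>)"
    using Suc.IH[of "Suc k"] unfolding S_def by blast
  \<comment> \<open>The value of the Beta function at \<alpha> and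
    \<open>real i * \<alpha> + 1\<close>.\<close>
  define D where "D = (\<lambda>i. Gamma \<alpha> * Gamma (real i * \<alpha> + 1) / Gamma (real (Suc i) * \<alpha> + 1))"
  have \<Gamma>: "Gamma \<alpha> > 0" "Gamma (real i * \<alpha> + 1) > 0" for i
    using \<alpha> by (auto intro!: Gamma_real_pos add_nonneg_pos)
  have D: "((\<lambda>s. (x - s) powr (\<alpha> - 1) * (s - a) powr (real i * \<alpha>)) has_integral
             D i * (x - a) powr (real (Suc i) * \<alpha>)) {a<..<x}" if "x \<in> {a<..b}" for x i
  proof -
    have "real i * \<alpha> + 1 > 0" using \<alpha> by (simp add: add_nonneg_pos)
    from has_integral_Beta_affine[OF \<alpha> this, of a x] show ?thesis
      using that by (simp add: D_def algebra_simps)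
  qed
  show ?case
  \<comment> \<open>Integrating the bound \<open>C * (s - a) powr (real m * \<alpha>)\<close>
    against the kernel gives the factor \<open>D m\<close>; division by
    \<open>Gamma \<alpha>\<close> comes from \<open>inv\<close>.\<close>
  proof (intro exI[of _ "C * D m / Gamma \<alpha>"] ballI)
    fix x assume x: "x \<in> {a<..b}"
    let ?L = "g k x - (\<Sum>i<Suc m. g (k + i) a / Gamma (real i * \<alpha> + 1) * (x - a) powr (real i * \<alpha>))"
    have "((\<lambda>s. (x - s) powr (\<alpha> - 1) * g (Suc k) s - (\<Sum>i<m. g (Suc k + i) a / Gamma (real i * \<alpha> + 1) *
          ((x - s) powr (\<alpha> - 1) * (s - a) powr (real i * \<alpha>)))) has_integral
        Gamma \<alpha> * (g k x - g k a) - (\<Sum>i<m. g (Suc k + i) a / Gamma (real i * \<alpha> + 1) *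
          (D i * (x - a) powr (real (Suc i) * \<alpha>)))) {a<..<x}"
      by (intro has_integral_diff has_integral_sum has_integral_mult_right inv D x) auto
    also have "(\<lambda>s. (x - s) powr (\<alpha> - 1) * g (Suc k) s - (\<Sum>i<m. g (Suc k + i) a / Gamma (real i * \<alpha> + 1) *
          ((x - s) powr (\<alpha> - 1) * (s - a) powr (real i * \<alpha>)))) =
        (\<lambda>s. (x - s) powr (\<alpha> - 1) * (g (Suc k) s - S s))"
      by (simp add: S_def right_diff_distrib sum_distrib_left mult_ac)
    also have "Gamma \<alpha> * (g k x - g k a) - (\<Sum>i<m. g (Suc k + i) a / Gamma (real i * \<alpha> + 1) *
          (D i * (x - a) powr (real (Suc i) * \<alpha>))) = Gamma \<alpha> * ?L"
    proof -
      \<comment> \<open>Integration turns term \<open>i\<close> for \<open>g (Suc k)\<close> into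
        term \<open>Suc i\<close> for \<open>g k\<close>, up to
        \<open>Gamma \<alpha>\<close>.\<close>
      have "g (Suc k + i) a / Gamma (real i * \<alpha> + 1) * (D i * (x - a) powr (real (Suc i) * \<alpha>)) =
         Gamma \<alpha> * (g (k + Suc i) a / Gamma (real (Suc i) * \<alpha> + 1) * (x - a) powr (real (Suc i) * \<alpha>))" for i
        using \<Gamma>(2)[of i] by (simp add: D_def)
      \<comment> \<open>The term \<open>i = 0\<close> is \<open>g k a\<close>: since
        \<open>x > a\<close>, the power with exponent 0 is 1.\<close>
      moreover have "?L = g k x - (g k a + (\<Sum>i<m. g (k + Suc i) a / Gamma (real (Suc i) * \<alpha> + 1) *
          (x - a) powr (real (Suc i) * \<alpha>)))"
        using x unfolding sum.lessThan_Suc_shift by simp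
      ultimately show ?thesis
        by (simp only: right_diff_distrib distrib_left sum_distrib_left diff_diff_eq)
    qed
    finally have R: "((\<lambda>s. (x - s) powr (\<alpha> - 1) * (g (Suc k) s - S s)) has_integral Gamma \<alpha> * ?L) {a<..<x}" .
    have M: "((\<lambda>s. C * ((x - s) powr (\<alpha> - 1) * (s - a) powr (real m * \<alpha>))) has_integral
        C * (D m * (x - a) powr (real (Suc m) * \<alpha>))) {a<..<x}"
      by (intro has_integral_mult_right D x)
    have le: "\<bar>(x - s) powr (\<alpha> - 1) * (g (Suc k) s - S s)\<bar> \<le> C * ((x - s) powr (\<alpha> - 1) * (s - a) powr (real m * \<alpha>))"
      if "s \<in> {a<..<x}" for s
      using mult_left_mono[OF C[of s], of "(x - s) powr (\<alpha> - 1)"] that x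
      by (simp add: abs_mult mult_ac)
    have "Gamma \<alpha> * ?L \<le> C * (D m * (x - a) powr (real (Suc m) * \<alpha>))"
      by (rule has_integral_le[OF R M]) (use le in \<open>auto simp: abs_le_iff\<close>)
    moreover have "- (Gamma \<alpha> * ?L) \<le> C * (D m * (x - a) powr (real (Suc m) * \<alpha>))"
      by (rule has_integral_le[OF has_integral_neg[OF R] M]) (use le in \<open>auto simp: abs_le_iff\<close>)
    ultimately have "\<bar>Gamma \<alpha> * ?L\<bar> \<le> C * (D m * (x - a) powr (real (Suc m) * \<alpha>))"
      by (simp only: abs_le_iff)
    then have "Gamma \<alpha> * \<bar>?L\<bar> \<le> C * (D m * (x - a) powr (real (Suc m) * \<alpha>))"
      using \<Gamma>(1) by (simp only: abs_mult abs_of_pos)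
    then show "\<bar>?L\<bar> \<le> C * D m / Gamma \<alpha> * (x - a) powr (real (Suc m) * \<alpha>)"
      using \<Gamma>(1) by (simp add: pos_le_divide_eq mult_ac del: of_nat_Suc sum.lessThan_Suc)
  qed
qed

section \<open>Germs representing Fermat reals\<close>

lemma Fermat_eqI: "fermat_rel x y \<Longrightarrow> Fermat x = Fermat y"
  by (rule Quotient_rel_abs[OF Quotient_fermat])

lemma Fermat_eqD:
  assumes "Fermat x = Fermat y" "little_oh_poly x" "little_oh_poly y"
  shows "(\<lambda>t. x t - y t) \<in> o[at_right 0](\<lambda>t. t)"
  using Quotient_rel[OF Quotient_fermat, of x y] assms
  by (simp add: fermat_rel_refl fermat_rel_def)

lemma little_oh_poly_cong_smallo:
  assumes "little_oh_poly y" "(\<lambda>t. x t - y t) \<in> o[at_right 0](\<lambda>t. t)"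
  shows "little_oh_poly x"
proof -
  obtain as where as: "\<forall>(a, e)\<in>set as. e \<ge> 0"
    "(\<lambda>t. y t - powr_sum as t) \<in> o[at_right 0](\<lambda>t. t)"
    using assms(1) by (rule little_oh_polyE)
  show ?thesis
    by (rule little_oh_polyI[OF as(1)]) (use sum_in_smallo(1)[OF assms(2) as(2)] in simp)
qed

text \<open>Little-oh polynomials are stable under \<open>o(t)\<close> perturbations, so the
  property passes from \<open>y\<close> to \<open>x\<close>.\<close>

lemma Fermat_eq_smalloI:
  assumes "little_oh_poly y" "(\<lambda>t. x t - y t) \<in> o[at_right 0](\<lambda>t. t)"
  shows "Fermat x = Fermat y"
  by (rule Fermat_eqI) (use assms little_oh_poly_cong_smallo[OF assms] in \<open>simp add: fermat_rel_def\<close>)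

lemma eventually_eq_imp_smallo:
  assumes "\<forall>\<^sub>F t in at_right 0. x t = y t"
  shows "(\<lambda>t. x t - y t) \<in> o[at_right (0::real)](\<lambda>t. t :: real)"
proof -
  have "\<forall>\<^sub>F t in at_right 0. x t - y t = 0"
    using assms by eventually_elim simp
  then show ?thesis using landau_o.small.in_cong[of "\<lambda>t. x t - y t" "\<lambda>_. 0"] by simp
qed

lemma Fermat_scaleR: "little_oh_poly x \<Longrightarrow> r *\<^sub>R Fermat x = Fermat (\<lambda>t. r * x t)"
  by (simp add: scaleR_fermat.abs_eq fermat_rel_refl)

lemma Fermat_plus: "little_oh_poly x \<Longrightarrow> little_oh_poly y \<Longrightarrow> Fermat x + Fermat y = Fermat (\<lambda>t. x t + y t)"
  by (simp add: plus_fermat.abs_eq fermat_rel_refl)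

lemma Fermat_times: "little_oh_poly x \<Longrightarrow> little_oh_poly y \<Longrightarrow> Fermat x * Fermat y = Fermat (\<lambda>t. x t * y t)"
  by (simp add: times_fermat.abs_eq fermat_rel_refl)

lemma little_oh_poly_scale: "little_oh_poly x \<Longrightarrow> little_oh_poly (\<lambda>t. r * x t)"
  by (rule little_oh_poly_mult[OF little_oh_poly_const])

lemma little_oh_poly_power: "little_oh_poly x \<Longrightarrow> little_oh_poly (\<lambda>t. x t ^ m)"
  by (induction m) (simp_all add: little_oh_poly_const little_oh_poly_mult)

lemma Fermat_power: "little_oh_poly x \<Longrightarrow> Fermat x ^ m = Fermat (\<lambda>t. x t ^ m)"
  by (induction m) (simp_all add: one_fermat.abs_eq Fermat_times little_oh_poly_power)

lemma little_oh_poly_sum: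
  "finite I \<Longrightarrow> (\<And>i. i \<in> I \<Longrightarrow> little_oh_poly (x i)) \<Longrightarrow> little_oh_poly (\<lambda>t. \<Sum>i\<in>I. x i t)"
  by (induction I rule: finite_induct) (simp_all add: little_oh_poly_const little_oh_poly_add)

lemma Fermat_sum:
  "finite I \<Longrightarrow> (\<And>i. i \<in> I \<Longrightarrow> little_oh_poly (x i)) \<Longrightarrow> (\<Sum>i\<in>I. Fermat (x i)) = Fermat (\<lambda>t. \<Sum>i\<in>I. x i t)"
  by (induction I rule: finite_induct) (simp_all add: zero_fermat.abs_eq Fermat_plus little_oh_poly_sum)

lemma little_oh_poly_powr_sum:
  "\<forall>(a, e)\<in>set as. e \<ge> 0 \<Longrightarrow> little_oh_poly (powr_sum as)"
  by (rule little_oh_polyI[of as]) simp_all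

lemma Fermat_powr_sum:
  "\<forall>(a, e)\<in>set as. e \<ge> 0 \<Longrightarrow> Fermat (powr_sum as) = (\<Sum>(a, e)\<leftarrow>as. a *\<^sub>R Fermat (\<lambda>t. t powr e))"
proof (induction as)
  case Nil
  then show ?case by (simp add: zero_fermat.abs_eq powr_sum_def)
next
  case (Cons p as)
  obtain a e where p: "p = (a, e)" by force
  then have "powr_sum (p # as) = (\<lambda>t. a * t powr e + powr_sum as t)" by auto
  then show ?case using Cons p
    by (simp add: Fermat_scaleR little_oh_poly_powr Fermat_plus[symmetric] little_oh_poly_scale little_oh_poly_powr_sum)
qed

section \<open>Asymptotics of power sums\<close>

lemma tendsto_powr_at_right_0: "e > 0 \<Longrightarrow> ((\<lambda>t::real. t powr e) \<longlongrightarrow> 0) (at_right 0)"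
  by (rule tendsto_zero_powrI[of _ _ _ e]) (auto intro!: tendsto_eq_intros eventually_at_rightI[of 0 1])

lemma powr_smallo_at_right_0:
  fixes p :: real
  assumes "p > 1" shows "(\<lambda>t. t powr p) \<in> o[at_right 0](\<lambda>t. t)"
proof (rule smalloI_tendsto)
  show "\<forall>\<^sub>F t in at_right 0. t \<noteq> (0::real)"
    using eventually_at_right_0_pos by eventually_elim simp
  have "((\<lambda>t. t powr (p - 1)) \<longlongrightarrow> 0) (at_right 0)"
    using assms by (intro tendsto_powr_at_right_0) simp
  moreover have "\<forall>\<^sub>F t in at_right 0. t powr (p - 1) = t powr p / t"
    using eventually_at_right_0_pos by eventually_elim (simp add: powr_diff)
  ultimately show "((\<lambda>t. t powr p / t) \<longlongrightarrow> 0) (at_right 0)"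
    by (rule Lim_transform_eventually)
qed

lemma powr_sum_tendsto_0:
  "\<forall>(a, e)\<in>set as. e > 0 \<Longrightarrow> (powr_sum as \<longlongrightarrow> 0) (at_right 0)"
proof (induction as)
  case Nil
  then show ?case by (simp add: powr_sum_def)
next
  case (Cons p as)
  obtain a e where p: "p = (a, e)" by force
  have "((\<lambda>t. a * t powr e + powr_sum as t) \<longlongrightarrow> a * 0 + 0) (at_right 0)"
    using Cons p by (intro tendsto_intros tendsto_powr_at_right_0) auto
  then show ?case by (simp add: p)
qed

lemma powr_sum_shift:
  "t > 0 \<Longrightarrow> powr_sum (map (\<lambda>(a, e). (c * a, e - d)) as) t = c * powr_sum as t / t powr d"
  by (induction as) (auto simp: powr_diff algebra_simps add_divide_distrib)

text \<open>After division by \<open>t powr e\<close> every other term still has a positive exponent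
  and tends to 0.\<close>

lemma powr_sum_lead_tendsto:
  assumes "\<forall>(a', e')\<in>set as. e < e'"
  shows "((\<lambda>t. powr_sum ((a, e) # as) t / t powr e) \<longlongrightarrow> a) (at_right 0)"
proof -
  have "(powr_sum (map (\<lambda>(a', e'). (1 * a', e' - e)) as) \<longlongrightarrow> 0) (at_right 0)"
    using assms by (intro powr_sum_tendsto_0) auto
  then have "((\<lambda>t. a + powr_sum (map (\<lambda>(a', e'). (1 * a', e' - e)) as) t) \<longlongrightarrow> a + 0) (at_right 0)"
    by (intro tendsto_intros)
  moreover have "\<forall>\<^sub>F t in at_right 0. a + powr_sum (map (\<lambda>(a', e'). (1 * a', e' - e)) as) t =
      powr_sum ((a, e) # as) t / t powr e"
    using eventually_at_right_0_pos
    by eventually_elim (simp only: powr_sum_shift, simp add: add_divide_distrib)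
  ultimately show ?thesis using Lim_transform_eventually by fastforce
qed

text \<open>Divided by \<open>t powr e\<close>, the difference tends to \<open>a\<close>; being
  \<open>o(t)\<close> with \<open>e \<le> 1\<close>, it also tends to 0.\<close>

lemma powr_sum_lead_eq_0:
  assumes "\<forall>(a', e')\<in>set as. e < e'" "\<forall>(a', e')\<in>set bs. e < e'" "e \<le> 1"
    and o: "(\<lambda>t. powr_sum ((a, e) # as) t - powr_sum bs t) \<in> o[at_right 0](\<lambda>t. t)"
  shows "a = 0"
proof -
  let ?d = "\<lambda>t. powr_sum ((a, e) # as) t - powr_sum bs t"
  \<comment> \<open>Padding \<open>bs\<close> with the zero term \<open>(0, e)\<close> lets the
    leading-term limit apply to both sums.\<close>
  have "((\<lambda>t. powr_sum ((a, e) # as) t / t powr e - powr_sum ((0, e) # bs) t / t powr e) \<longlongrightarrow> a - 0) (at_right 0)"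
    by (intro tendsto_intros powr_sum_lead_tendsto assms)
  then have lim: "((\<lambda>t. ?d t / t powr e) \<longlongrightarrow> a) (at_right 0)"
    by (simp add: diff_divide_distrib)
  have "(\<lambda>t::real. t) \<in> O[at_right 0](\<lambda>t. t powr e)"
  proof (rule bigoI[of _ 1])
    show "\<forall>\<^sub>F t in at_right 0. norm t \<le> 1 * norm (t powr e)"
      using eventually_at_right_0_pos
      by eventually_elim (use \<open>e \<le> 1\<close> powr_mono'[of e 1] in auto)
  qed
  with o have "?d \<in> o[at_right 0](\<lambda>t. t powr e)"
    by (rule landau_o.small_big_trans)
  then have "((\<lambda>t. ?d t / t powr e) \<longlongrightarrow> 0) (at_right 0)"
    by (rule smalloD_tendsto)
  with lim show ?thesis
    by (intro tendsto_unique[of "at_right (0::real)"]) auto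
qed

text \<open>The lists are peeled from the smallest exponent. Different leading exponents, or
  different leading coefficients, would leave a nonzero leading term in a difference that is
  \<open>o(t)\<close>.\<close>

lemma powr_sum_unique:
  assumes "sorted_wrt (\<lambda>(a, e) (a', e'). e < e') as" "sorted_wrt (\<lambda>(a, e) (a', e'). e < e') bs"
    and "\<forall>(a, e)\<in>set as. a \<noteq> 0 \<and> e \<le> 1" "\<forall>(a, e)\<in>set bs. a \<noteq> 0 \<and> e \<le> 1"
    and "(\<lambda>t. powr_sum as t - powr_sum bs t) \<in> o[at_right 0](\<lambda>t. t)"
  shows "as = bs"
  using assms
proof (induction as arbitrary: bs)
  case Nil
  show ?case
  proof (cases bs)
    case (Cons p bs')
    obtain a e where p: "p = (a, e)" by force
    have "(\<lambda>t. - (powr_sum [] t - powr_sum bs t)) \<in> o[at_right 0](\<lambda>t. t)"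
      using Nil.prems(5) by (subst landau_o.small.uminus_in_iff)
    then have "(\<lambda>t. powr_sum ((a, e) # bs') t - powr_sum [] t) \<in> o[at_right 0](\<lambda>t. t)"
      by (simp add: Cons p algebra_simps)
    then have "a = 0"
      by (rule powr_sum_lead_eq_0[rotated 3]) (use Nil.prems Cons p in auto)
    with Nil.prems Cons p show ?thesis by auto
  qed simp
next
  case (Cons p as)
  obtain a e where p: "p = (a, e)" by force
  show ?case
  proof (cases bs)
    case Nil
    have "a = 0"
      using Cons.prems Nil p by (intro powr_sum_lead_eq_0[of as e "[]" a]) auto
    with Cons.prems p show ?thesis by auto
  next
    case bs: (Cons p' bs')
    obtain a' e' where p': "p' = (a', e')" by force
    have neg: "(\<lambda>t. powr_sum bs t - powr_sum (p # as) t) \<in> o[at_right 0](\<lambda>t. t)"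
      using Cons.prems(5) landau_o.small.uminus_in_iff[of "\<lambda>t. powr_sum (p # as) t - powr_sum bs t"] by simp
    have "\<not> e < e'"
    proof
      assume "e < e'"
      then have "a = 0"
        using Cons.prems bs p p' by (intro powr_sum_lead_eq_0[of as e bs a]) auto
      with Cons.prems p show False by auto
    qed
    moreover have "\<not> e' < e"
    proof
      assume "e' < e"
      then have "a' = 0"
        using Cons.prems neg bs p p' by (intro powr_sum_lead_eq_0[of bs' e' "p # as" a']) auto
      with Cons.prems bs p' show False by auto
    qed
    ultimately have e: "e' = e" by simp
    have "a - a' = 0"
    proof (rule powr_sum_lead_eq_0[of as e bs'])
      show "(\<lambda>t. powr_sum ((a - a', e) # as) t - powr_sum bs' t) \<in> o[at_right 0](\<lambda>t. t)"
        using Cons.prems(5) by (simp add: p bs p' e algebra_simps)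
    qed (use Cons.prems bs p p' e in auto)
    moreover have "as = bs'"
    proof (rule Cons.IH)
      show "(\<lambda>t. powr_sum as t - powr_sum bs' t) \<in> o[at_right 0](\<lambda>t. t)"
        using Cons.prems(5) \<open>a - a' = 0\<close> by (simp add: p bs p' e)
    qed (use Cons.prems bs p p' in auto)
    ultimately show ?thesis by (simp add: p bs p' e)
  qed
qed

section \<open>Existence and uniqueness of the decomposition\<close>

text \<open>Passes from the orders \<beta> of a decomposition to the exponents of its
  representative. Strictly decreasing orders become strictly increasing exponents, as
  \<open>powr_sum_unique\<close> expects.\<close>

definition recip_exps :: "(real \<times> real) list \<Rightarrow> (real \<times> real) list" where
  "recip_exps bs = map (\<lambda>(b, \<beta>). (b, 1 / \<beta>)) bs"

lemma set_recip_exps: "(\<forall>(a, e)\<in>set (recip_exps bs). P a e) \<longleftrightarrow> (\<forall>(b, \<beta>)\<in>set bs. P b (1 / \<beta>))"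
  by (auto simp: recip_exps_def)

lemma recip_exps_pos: "\<forall>(b, \<beta>)\<in>set bs. \<beta> \<ge> 1 \<Longrightarrow> \<forall>(a, e)\<in>set (recip_exps bs). e > 0"
  by (induction bs) (auto simp: recip_exps_def)

lemma recip_exps_greater:
  "\<forall>(b', \<beta>')\<in>set bs. \<beta>' \<ge> 1 \<and> \<beta>' < \<beta> \<Longrightarrow> \<forall>(a, e)\<in>set (recip_exps bs). 1 / \<beta> < e"
  by (induction bs) (auto simp: recip_exps_def intro!: divide_strict_left_mono)

lemma Fermat_recip_exps:
  assumes "\<forall>(b, \<beta>)\<in>set bs. \<beta> \<ge> 0"
  shows "Fermat (powr_sum (recip_exps bs)) = (\<Sum>(b, \<beta>)\<leftarrow>bs. b *\<^sub>R dt \<beta>)"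
  using assms by (subst Fermat_powr_sum)
    (auto simp: set_recip_exps recip_exps_def dt_def o_def case_prod_unfold)

lemma is_decomposition_altdef:
  "is_decomposition x (r, bs) \<longleftrightarrow> sorted_wrt (\<lambda>(b, \<beta>) (b', \<beta>'). \<beta> > \<beta>') bs \<and>
     (\<forall>(b, \<beta>)\<in>set bs. b \<noteq> 0 \<and> \<beta> \<ge> 1) \<and> x = Fermat (powr_sum ((r, 0) # recip_exps bs))"
proof (cases "\<forall>(b, \<beta>)\<in>set bs. b \<noteq> 0 \<and> \<beta> \<ge> 1")
  case True
  then have pos: "\<forall>(b, \<beta>)\<in>set bs. \<beta> \<ge> 0" by auto
  have lop: "little_oh_poly (powr_sum (recip_exps bs))"
    using pos by (intro little_oh_poly_powr_sum) (simp add: set_recip_exps)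
  \<comment> \<open>Since \<open>0 powr 0 = 0\<close>, the constant \<open>r\<close> and the term
    \<open>(r, 0)\<close> differ at \<open>t = 0\<close>; they agree for \<open>t > 0\<close>, which
    determines the germ.\<close>
  have "Fermat (\<lambda>t. r + powr_sum (recip_exps bs) t) = Fermat (powr_sum ((r, 0) # recip_exps bs))"
  proof (rule Fermat_eq_smalloI)
    show "little_oh_poly (powr_sum ((r, 0) # recip_exps bs))"
      using pos by (intro little_oh_poly_powr_sum) (simp add: set_recip_exps)
    show "(\<lambda>t. r + powr_sum (recip_exps bs) t - powr_sum ((r, 0) # recip_exps bs) t) \<in> o[at_right 0](\<lambda>t. t)"
      by (rule eventually_eq_imp_smallo) (use eventually_at_right_0_pos in eventually_elim, simp)
  qed
  then have "of_real r + (\<Sum>(b, \<beta>)\<leftarrow>bs. b *\<^sub>R dt \<beta>) = Fermat (powr_sum ((r, 0) # recip_exps bs))"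
    using lop by (simp add: of_real_fermat Fermat_recip_exps[OF pos, symmetric] Fermat_plus little_oh_poly_const)
  then show ?thesis by (simp add: is_decomposition_def)
qed (auto simp: is_decomposition_def)

text \<open>The standard part is compared first, as the coefficient of exponent 0, because it may
  vanish while \<open>powr_sum_unique\<close> asks for nonzero coefficients. The infinitesimal terms
  follow from that lemma.\<close>

lemma decomposition_unique:
  assumes "is_decomposition x (r, bs)" "is_decomposition x (r', bs')"
  shows "(r, bs) = (r', bs')"
proof -
  have sorted: "sorted_wrt (\<lambda>(a, e) (a', e'). e < e') (recip_exps bs)"
    and props: "\<forall>(a, e)\<in>set (recip_exps bs). a \<noteq> 0 \<and> 0 < e \<and> e \<le> 1"
    and lop: "little_oh_poly (powr_sum ((r, 0) # recip_exps bs))"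
    if "is_decomposition x (r, bs)" for r bs
  proof -
    have s: "sorted_wrt (\<lambda>(b, \<beta>) (b', \<beta>'). \<beta> > \<beta>') bs" and b: "\<forall>(b, \<beta>)\<in>set bs. b \<noteq> 0 \<and> \<beta> \<ge> 1"
      using that by (auto simp: is_decomposition_altdef)
    show "sorted_wrt (\<lambda>(a, e) (a', e'). e < e') (recip_exps bs)"
      unfolding recip_exps_def sorted_wrt_map
      by (rule sorted_wrt_mono_rel[OF _ s]) (use b in \<open>force intro!: divide_strict_left_mono\<close>)
    show p: "\<forall>(a, e)\<in>set (recip_exps bs). a \<noteq> 0 \<and> 0 < e \<and> e \<le> 1"
      using b by (auto simp: set_recip_exps)
    then show "little_oh_poly (powr_sum ((r, 0) # recip_exps bs))"
      by (intro little_oh_poly_powr_sum) auto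
  qed
  have o: "(\<lambda>t. powr_sum ((r, 0) # recip_exps bs) t - powr_sum ((r', 0) # recip_exps bs') t) \<in> o[at_right 0](\<lambda>t. t)"
    by (rule Fermat_eqD[OF _ assms[THEN lop]]) (use assms in \<open>metis is_decomposition_altdef\<close>)
  have "r - r' = 0"
  proof (rule powr_sum_lead_eq_0[of "recip_exps bs" 0 "recip_exps bs'"])
    show "(\<lambda>t. powr_sum ((r - r', 0) # recip_exps bs) t - powr_sum (recip_exps bs') t) \<in> o[at_right 0](\<lambda>t. t)"
      using o by (simp add: algebra_simps)
  qed (use assms[THEN props] in auto)
  moreover have "recip_exps bs = recip_exps bs'"
  proof (rule powr_sum_unique[OF assms[THEN sorted]])
    show "(\<lambda>t. powr_sum (recip_exps bs) t - powr_sum (recip_exps bs') t) \<in> o[at_right 0](\<lambda>t. t)"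
      using o \<open>r - r' = 0\<close> by simp
  qed (use assms[THEN props] in auto)
  \<comment> \<open>With the convention \<open>1 / 0 = 0\<close>, taking reciprocals is injective on
    all reals.\<close>
  moreover have "inj (\<lambda>(b :: real, \<beta>). (b, 1 / \<beta> :: real))"
    by (auto simp: inj_on_def)
  ultimately show ?thesis
    by (simp add: recip_exps_def inj_map_eq_map)
qed

lemma Fermat_powr_eq_0: "e > 1 \<Longrightarrow> Fermat (\<lambda>t. t powr e) = 0"
  unfolding zero_fermat.abs_eq
  by (rule Fermat_eq_smalloI) (auto intro: little_oh_poly_const powr_smallo_at_right_0)

text \<open>Exponents above 1 contribute 0 in the quotient, and equal exponents are merged by adding
  coefficients. At this stage \<open>c\<close> may still vanish on parts of \<open>E\<close>, for
  instance after cancellation.\<close>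

lemma Fermat_powr_sum_collect:
  assumes "\<forall>(a, e)\<in>set as. e \<ge> 0"
  shows "\<exists>E c. finite E \<and> E \<subseteq> {0..1} \<and> (\<forall>e. e \<notin> E \<longrightarrow> c e = 0) \<and>
    Fermat (powr_sum as) = (\<Sum>e\<in>E. c e *\<^sub>R Fermat (\<lambda>t. t powr e))"
  unfolding Fermat_powr_sum[OF assms] using assms
proof (induction as)
  case Nil
  then show ?case by (intro exI[of _ "{}"] exI[of _ "\<lambda>_. 0"]) simp
next
  case (Cons p as)
  obtain a e where p: "p = (a, e)" by force
  obtain E c where E: "finite E" "E \<subseteq> {0..1}" "\<forall>e. e \<notin> E \<longrightarrow> c e = 0"
    "(\<Sum>(a, e)\<leftarrow>as. a *\<^sub>R Fermat (\<lambda>t. t powr e)) = (\<Sum>e\<in>E. c e *\<^sub>R Fermat (\<lambda>t. t powr e))"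
    using Cons by auto
  show ?case
  proof (cases "e > 1")
    case True
    then show ?thesis using E by (intro exI[of _ E] exI[of _ c]) (simp add: p Fermat_powr_eq_0)
  next
    case False
    have "(\<Sum>x\<in>insert e E. (c x + (if x = e then a else 0)) *\<^sub>R Fermat (\<lambda>t. t powr x)) =
        (\<Sum>x\<in>insert e E. c x *\<^sub>R Fermat (\<lambda>t. t powr x)) +
        (\<Sum>x\<in>insert e E. if x = e then a *\<^sub>R Fermat (\<lambda>t. t powr x) else 0)"
      by (simp only: scaleR_left_distrib flip: sum.distrib) (auto intro!: sum.cong)
    \<comment> \<open>As \<open>c\<close> vanishes off \<open>E\<close>, a newly inserted
      \<open>e\<close> adds nothing to this sum.\<close>
    also have "(\<Sum>x\<in>insert e E. c x *\<^sub>R Fermat (\<lambda>t. t powr x)) = (\<Sum>x\<in>E. c x *\<^sub>R Fermat (\<lambda>t. t powr x))"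
      using E by (intro sum.mono_neutral_right) auto
    finally show ?thesis
      using E False Cons.prems
      by (intro exI[of _ "insert e E"] exI[of _ "\<lambda>x. c x + (if x = e then a else 0)"]) (auto simp: p)
  qed
qed

lemma decomposition_exists: "\<exists>r bs. is_decomposition x (r, bs)"
proof -
  obtain y where x: "x = Fermat y" and y: "little_oh_poly y"
    by (induction x rule: fermat.abs_induct) (auto simp: fermat_rel_def)
  obtain as where as: "\<forall>(a, e)\<in>set as. e \<ge> 0" "(\<lambda>t. y t - powr_sum as t) \<in> o[at_right 0](\<lambda>t. t)"
    using y by (rule little_oh_polyE)
  have "x = Fermat (powr_sum as)"
    unfolding x using as by (intro Fermat_eq_smalloI little_oh_poly_powr_sum)
  with Fermat_powr_sum_collect[OF as(1)] obtain E c where E: "finite E" "E \<subseteq> {0..1}" "\<forall>e. e \<notin> E \<longrightarrow> c e = 0"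
    and x: "x = (\<Sum>e\<in>E. c e *\<^sub>R Fermat (\<lambda>t. t powr e))" by auto
  \<comment> \<open>The exponents of the genuine infinitesimal terms: zero coefficients are
    discarded, and exponent 0 is split off as the standard part.\<close>
  define B where "B = {e\<in>E. c e \<noteq> 0 \<and> e \<noteq> 0}"
  have B: "finite B" "B \<subseteq> {0<..1}" using E by (auto simp: B_def order.order_iff_strict)
  define as' where "as' = map (\<lambda>e. (c e, e)) (sorted_list_of_set B)"
  define bs where "bs = map (\<lambda>e. (c e, 1 / e)) (sorted_list_of_set B)"
  have rec: "recip_exps bs = as'" by (simp add: recip_exps_def bs_def as'_def)
  \<comment> \<open>If 0 is not in \<open>E\<close>, then \<open>c 0 = 0\<close>, so including it is
    harmless.\<close>
  have "x = (\<Sum>e\<in>insert 0 B. c e *\<^sub>R Fermat (\<lambda>t. t powr e))"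
    unfolding x using E by (intro sum.mono_neutral_cong) (auto simp: B_def)
  also have "\<dots> = c 0 *\<^sub>R Fermat (\<lambda>t. t powr 0) + (\<Sum>e\<in>B. c e *\<^sub>R Fermat (\<lambda>t. t powr e))"
    using B by (subst sum.insert) (auto simp: B_def)
  also have "(\<Sum>e\<in>B. c e *\<^sub>R Fermat (\<lambda>t. t powr e)) = (\<Sum>(a, e)\<leftarrow>as'. a *\<^sub>R Fermat (\<lambda>t. t powr e))"
    using B by (simp add: as'_def o_def sum_list_distinct_conv_sum_set)
  also have "c 0 *\<^sub>R Fermat (\<lambda>t. t powr 0) + \<dots> = Fermat (powr_sum ((c 0, 0) # recip_exps bs))"
    using B by (subst Fermat_powr_sum) (auto simp: rec as'_def)
  finally have "is_decomposition x (c 0, bs)"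
    unfolding is_decomposition_altdef
  proof (intro conjI)
    have "sorted_wrt (\<lambda>x y. 1 / x > 1 / y) (sorted_list_of_set B)"
      by (rule sorted_wrt_mono_rel[OF _ strict_sorted_list_of_set]) (use B in \<open>auto intro!: divide_strict_left_mono\<close>)
    then show "sorted_wrt (\<lambda>(b, \<beta>) (b', \<beta>'). \<beta> > \<beta>') bs"
      by (simp add: bs_def sorted_wrt_map)
    show "\<forall>(b, \<beta>)\<in>set bs. b \<noteq> 0 \<and> \<beta> \<ge> 1"
      using B by (auto simp: bs_def B_def)
  qed
  then show ?thesis by blast
qed

lemma is_decomposition_decomposition: "is_decomposition x (std_part x, inf_terms x)"
proof -
  obtain r bs where d: "is_decomposition x (r, bs)"
    using decomposition_exists by blast
  then have "decomposition x = (r, bs)"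
    unfolding decomposition_def by (rule the_equality) (metis decomposition_unique d prod.exhaust)
  with d show ?thesis by (simp add: std_part_def inf_terms_def)
qed

section \<open>Powers\<close>

lemma powr_bigo_at_right_0:
  fixes p q :: real
  assumes "q \<le> p" shows "(\<lambda>t. t powr p) \<in> O[at_right 0](\<lambda>t. t powr q)"
proof (rule bigoI[of _ 1])
  show "\<forall>\<^sub>F t in at_right 0. norm (t powr p) \<le> 1 * norm (t powr q)"
    using eventually_at_right_0_pos
    by eventually_elim (use assms powr_mono' in auto)
qed

text \<open>The minimum of the exponents gives a rate of decay, from which the nilpotency of
  infinitesimals is derived.\<close>

lemma powr_sum_bigo_powr:
  "\<forall>(a, e)\<in>set as. e > 0 \<Longrightarrow> \<exists>\<gamma>>0. powr_sum as \<in> O[at_right 0](\<lambda>t. t powr \<gamma>)"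
proof (induction as)
  case Nil
  then show ?case by (intro exI[of _ 1]) (simp add: powr_sum_def)
next
  case (Cons p as)
  obtain a e where p: "p = (a, e)" by force
  obtain \<gamma> where \<gamma>: "\<gamma> > 0" "powr_sum as \<in> O[at_right 0](\<lambda>t. t powr \<gamma>)"
    using Cons by auto
  have "(\<lambda>t. a * t powr e) \<in> O[at_right 0](\<lambda>t. t powr min e \<gamma>)"
    using landau_o.big_mult[OF bigo_const[of a] powr_bigo_at_right_0[of "min e \<gamma>" e]] by simp
  moreover have "powr_sum as \<in> O[at_right 0](\<lambda>t. t powr min e \<gamma>)"
    by (rule landau_o.big_trans[OF \<gamma>(2)]) (intro powr_bigo_at_right_0, simp)
  ultimately have "(\<lambda>t. a * t powr e + powr_sum as t) \<in> O[at_right 0](\<lambda>t. t powr min e \<gamma>)"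
    by (rule sum_in_bigo)
  then show ?case using \<gamma>(1) Cons.prems p
    by (intro exI[of _ "min e \<gamma>"]) simp
qed

text \<open>The tail of the binomial series is \<open>z ^ M\<close> times a power series
  \<open>S\<close>, which is continuous and hence bounded on the compact interval where
  \<open>\<bar>z\<bar> \<le> 1 / 2\<close>.\<close>

lemma gen_binomial_remainder:
  "\<exists>C. \<forall>z. \<bar>z\<bar> \<le> 1 / 2 \<longrightarrow> \<bar>(1 + z) powr p - (\<Sum>m<M. (p gchoose m) * z ^ m)\<bar> \<le> C * \<bar>z :: real\<bar> ^ M"
proof -
  define S where "S = (\<lambda>z. \<Sum>n. (p gchoose (n + M)) * z ^ n)"
  have summable: "summable (\<lambda>n. (p gchoose n) * z ^ n)" if "\<bar>z\<bar> < 1" for z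
    using gen_binomial_real[OF that] by (rule sums_summable)
  \<comment> \<open>Any point strictly between 1/2 and 1 serves: convergence there gives continuity
    of \<open>S\<close> for \<open>\<bar>z\<bar> \<le> 1 / 2\<close>.\<close>
  have "summable (\<lambda>n. (p gchoose (n + M)) * (3 / 4) ^ (n + M) / (3 / 4) ^ M)"
    by (intro summable_divide summable_ignore_initial_segment summable) simp
  then have "summable (\<lambda>n. (p gchoose (n + M)) * (3 / 4) ^ n)"
    by (simp add: power_add)
  then have "isCont S z" if "\<bar>z\<bar> \<le> 1 / 2" for z
    unfolding S_def by (rule isCont_powser) (use that in auto)
  then have "compact (S ` {-1/2..1/2})"
    by (intro compact_continuous_image continuous_at_imp_continuous_on) auto
  then obtain C where "\<forall>z\<in>{-1/2..1/2}. \<bar>S z\<bar> \<le> C"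
    by (auto dest!: compact_imp_bounded simp: bounded_iff)
  then have C: "\<bar>S z\<bar> \<le> C" if "\<bar>z\<bar> \<le> 1 / 2" for z
  proof -
    have "z \<in> {-1/2..1/2}" using that by (auto simp: abs_le_iff)
    with \<open>\<forall>z\<in>{-1/2..1/2}. \<bar>S z\<bar> \<le> C\<close> show ?thesis by (rule bspec)
  qed
  have eq: "(1 + z) powr p - (\<Sum>m<M. (p gchoose m) * z ^ m) = z ^ M * S z" if z: "\<bar>z\<bar> \<le> 1 / 2" for z
  \<comment> \<open>The factor \<open>z ^ M\<close> is divided out below, so 0 is treated
    apart.\<close>
  proof (cases "z = 0")
    case True
    then show ?thesis by (cases M) (simp_all add: lessThan_Suc_eq_insert_0 sum.reindex S_def zero_power del: sum.lessThan_Suc)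
  next
    case False
    from z have z1: "\<bar>z\<bar> < 1" by simp
    have "(1 + z) powr p = (\<Sum>n. (p gchoose n) * z ^ n)"
      using gen_binomial_real[OF z1] by (rule sums_unique)
    also have "\<dots> = (\<Sum>n. (p gchoose (n + M)) * z ^ (n + M)) + (\<Sum>m<M. (p gchoose m) * z ^ m)"
      by (rule suminf_split_initial_segment[OF summable[OF z1]])
    also have "(\<Sum>n. (p gchoose (n + M)) * z ^ (n + M)) = z ^ M * S z"
    proof -
      have "summable (\<lambda>n. (p gchoose (n + M)) * z ^ (n + M) / z ^ M)"
        by (intro summable_divide summable_ignore_initial_segment summable z1)
      then have "summable (\<lambda>n. (p gchoose (n + M)) * z ^ n)"
        using False by (simp add: power_add)
      then show ?thesis unfolding S_def by (subst suminf_mult[symmetric]) (auto simp: power_add mult_ac)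
    qed
    finally show ?thesis by simp
  qed
  have "\<bar>(1 + z) powr p - (\<Sum>m<M. (p gchoose m) * z ^ m)\<bar> \<le> C * \<bar>z\<bar> ^ M" if "\<bar>z\<bar> \<le> 1 / 2" for z
  proof -
    have "\<bar>z ^ M\<bar> * \<bar>S z\<bar> \<le> \<bar>z ^ M\<bar> * C"
      using C[of z] that by (intro mult_left_mono) auto
    with eq[OF that] show ?thesis by (simp add: abs_mult power_abs mult.commute)
  qed
  then show ?thesis by blast
qed

text \<open>Powers of \<kappa> from some \<open>M\<close> on are \<open>o(t)\<close>. The algebraic
  sum therefore stops before \<open>M\<close>, and the analytic binomial series differs from its
  truncation at \<open>M\<close> by a multiple of \<kappa> to the power \<open>M\<close>.\<close>

lemma one_plus_power_Fermat:
  assumes \<kappa>: "little_oh_poly \<kappa>" and big: "\<kappa> \<in> O[at_right 0](\<lambda>t. t powr \<gamma>)" and \<gamma>: "\<gamma> > 0"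
  shows "little_oh_poly (\<lambda>t. (1 + \<kappa> t) powr p)" (is ?A)
    and "one_plus_power (Fermat \<kappa>) p = Fermat (\<lambda>t. (1 + \<kappa> t) powr p)" (is ?B)
proof -
  \<comment> \<open>This makes \<gamma> times \<open>M\<close> exceed 1, so that the
    \<open>M\<close>-th power is \<open>o(t)\<close>.\<close>
  obtain M where M: "real M > 1 / \<gamma>" using reals_Archimedean2 by blast
  with \<gamma> have \<gamma>M: "\<gamma> * real M > 1" by (simp add: field_simps)
  then have "M > 0" by (cases M) auto
  have pow_small: "(\<lambda>t. \<kappa> t ^ m) \<in> o[at_right 0](\<lambda>t. t)" if "m \<ge> M" for m
  proof -
    have "(\<lambda>t. \<kappa> t ^ m) \<in> O[at_right 0](\<lambda>t. (t powr \<gamma>) ^ m)"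
      by (rule landau_o.big_power[OF big])
    also have "(\<lambda>t. (t powr \<gamma>) ^ m) \<in> \<Theta>[at_right 0](\<lambda>t. t powr (\<gamma> * real m))"
    proof (rule bigthetaI_cong)
      show "\<forall>\<^sub>F t in at_right 0. (t powr \<gamma>) ^ m = t powr (\<gamma> * real m)"
        using eventually_at_right_0_pos by eventually_elim (simp add: powr_powr flip: powr_realpow)
    qed
    also have "(\<lambda>t. t powr (\<gamma> * real m)) \<in> o[at_right 0](\<lambda>t. t)"
    proof (rule powr_smallo_at_right_0)
      have "\<gamma> * real M \<le> \<gamma> * real m" using that \<gamma> by simp
      with \<gamma>M show "1 < \<gamma> * real m" by linarith
    qed
    finally show ?thesis .
  qed
  let ?S = "\<lambda>t. \<Sum>m<M. (p gchoose m) * \<kappa> t ^ m"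
  have zero: "Fermat \<kappa> ^ m = 0" if "m \<ge> M" for m
    unfolding Fermat_power[OF \<kappa>] zero_fermat.abs_eq
    by (rule Fermat_eq_smalloI) (use pow_small[OF that] in \<open>simp_all add: little_oh_poly_const\<close>)
  have lop: "little_oh_poly (\<lambda>t. (p gchoose m) * \<kappa> t ^ m)" for m
    by (intro little_oh_poly_scale little_oh_poly_power \<kappa>)
  have "one_plus_power (Fermat \<kappa>) p = 1 + (\<Sum>m\<in>{1..<M}. (p gchoose m) *\<^sub>R Fermat \<kappa> ^ m)"
    unfolding one_plus_power_def
    by (rule arg_cong[of _ _ "(+) 1"], rule sum.mono_neutral_left) (use zero in \<open>auto simp: not_le[symmetric]\<close>)
  also have "\<dots> = (\<Sum>m\<in>insert 0 {1..<M}. (p gchoose m) *\<^sub>R Fermat \<kappa> ^ m)"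
    by simp
  also have "insert 0 {1..<M} = {..<M}"
    using \<open>M > 0\<close> by auto
  also have "(\<Sum>m<M. (p gchoose m) *\<^sub>R Fermat \<kappa> ^ m) = Fermat ?S"
    using lop by (simp add: Fermat_power \<kappa> Fermat_scaleR little_oh_poly_power Fermat_sum)
  finally have eq: "one_plus_power (Fermat \<kappa>) p = Fermat ?S" .
  have S: "little_oh_poly ?S"
    using lop by (intro little_oh_poly_sum) auto
  obtain C where C: "\<And>z. \<bar>z\<bar> \<le> 1 / 2 \<Longrightarrow>
      \<bar>(1 + z) powr p - (\<Sum>m<M. (p gchoose m) * z ^ m)\<bar> \<le> C * \<bar>z\<bar> ^ M"
    using gen_binomial_remainder by blast
  have "(\<lambda>t::real. t powr \<gamma>) \<in> o[at_right 0](\<lambda>_. 1)"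
    using tendsto_powr_at_right_0[OF \<gamma>] by (intro smalloI_tendsto) simp_all
  with big have "\<kappa> \<in> o[at_right 0](\<lambda>_. 1)"
    by (rule landau_o.big_small_trans)
  then have "\<forall>\<^sub>F t in at_right 0. norm (\<kappa> t) \<le> 1 / 2 * norm (1 :: real)"
    by (rule landau_o.smallD) simp
  then have "(\<lambda>t. (1 + \<kappa> t) powr p - ?S t) \<in> O[at_right 0](\<lambda>t. \<kappa> t ^ M)"
    by (intro bigoI[of _ C]) (auto elim!: eventually_mono simp: power_abs intro!: C)
  then have o: "(\<lambda>t. (1 + \<kappa> t) powr p - ?S t) \<in> o[at_right 0](\<lambda>t. t)"
    using pow_small[OF order.refl] by (rule landau_o.big_small_trans)
  show ?A by (rule little_oh_poly_cong_smallo[OF S o])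
  show ?B unfolding eq by (rule Fermat_eq_smalloI[OF S o, symmetric])
qed

section \<open>The representative \<open>h_t\<close> of an infinitesimal and its real powers\<close>

definition germ :: "fermat \<Rightarrow> real \<Rightarrow> real" where
  "germ h = powr_sum (recip_exps (inf_terms h))"

lemma fermat_value_germ: "fermat_value f a h = Fermat (\<lambda>t. f (a + germ h t))"
  by (simp add: fermat_value_def germ_def powr_sum_def recip_exps_def o_def case_prod_unfold)

lemma pos_infinitesimalE:
  assumes "pos_infinitesimal h"
  obtains b \<beta> bs where "inf_terms h = (b, \<beta>) # bs" "b > 0" "\<beta> \<ge> 1"
    "\<forall>(b', \<beta>')\<in>set bs. \<beta>' \<ge> 1 \<and> \<beta>' < \<beta>"
proof -
  have d: "is_decomposition h (0, inf_terms h)"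
    using is_decomposition_decomposition[of h] assms by (simp add: pos_infinitesimal_def)
  show ?thesis
  proof (cases "inf_terms h")
    case Nil
    with d have "h = 0" by (simp add: is_decomposition_def)
    with assms show ?thesis by (simp add: pos_infinitesimal_def)
  next
    case (Cons p bs)
    then show ?thesis
      using d assms by (intro that[of "fst p" "snd p" bs]) (auto simp: is_decomposition_def pos_infinitesimal_def)
  qed
qed

lemma germ_tendsto_0: "pos_infinitesimal h \<Longrightarrow> (germ h \<longlongrightarrow> 0) (at_right 0)"
  unfolding germ_def
  by (erule pos_infinitesimalE, intro powr_sum_tendsto_0 recip_exps_pos) auto

lemma germ_lead_tendsto:
  assumes "inf_terms h = (b, \<beta>) # bs" "\<beta> \<ge> 1" "\<forall>(b', \<beta>')\<in>set bs. \<beta>' \<ge> 1 \<and> \<beta>' < \<beta>"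
  shows "((\<lambda>t. germ h t / t powr (1 / \<beta>)) \<longlongrightarrow> b) (at_right 0)"
proof -
  have "((\<lambda>t. powr_sum ((b, 1 / \<beta>) # recip_exps bs) t / t powr (1 / \<beta>)) \<longlongrightarrow> b) (at_right 0)"
    by (intro powr_sum_lead_tendsto recip_exps_greater assms)
  then show ?thesis by (simp add: germ_def assms recip_exps_def)
qed

lemma germ_pos:
  assumes "pos_infinitesimal h"
  shows "\<forall>\<^sub>F t in at_right 0. germ h t > 0"
proof -
  obtain b \<beta> bs where h: "inf_terms h = (b, \<beta>) # bs" "b > 0" "\<beta> \<ge> 1"
    "\<forall>(b', \<beta>')\<in>set bs. \<beta>' \<ge> 1 \<and> \<beta>' < \<beta>"
    using assms by (rule pos_infinitesimalE)
  have "\<forall>\<^sub>F t in at_right 0. germ h t / t powr (1 / \<beta>) > 0"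
    using order_tendstoD(1)[OF germ_lead_tendsto[OF h(1,3,4)] h(2)] .
  with eventually_at_right_0_pos show ?thesis
    by eventually_elim (simp add: zero_less_divide_iff)
qed

text \<open>The germ is asymptotic to \<open>b * t powr (1 / \<beta>)\<close> with \<beta> the order
  of \<open>h\<close>; its power is thus \<open>O(t powr (p / \<beta>))\<close>, where
  \<open>p / \<beta> > 1\<close>.\<close>

lemma germ_powr_smallo:
  assumes "pos_infinitesimal h" "fermat_order h < p"
  shows "(\<lambda>t. germ h t powr p) \<in> o[at_right 0](\<lambda>t. t)"
proof -
  obtain b \<beta> bs where h: "inf_terms h = (b, \<beta>) # bs" "b > 0" "\<beta> \<ge> 1"
    "\<forall>(b', \<beta>')\<in>set bs. \<beta>' \<ge> 1 \<and> \<beta>' < \<beta>"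
    using assms(1) by (rule pos_infinitesimalE)
  have p: "\<beta> < p" using assms(2) h by (simp add: fermat_order_def)
  have "((\<lambda>t. (germ h t / t powr (1 / \<beta>)) powr p) \<longlongrightarrow> b powr p) (at_right 0)"
    using h by (intro tendsto_intros germ_lead_tendsto[OF h(1,3,4)]) auto
  then have "(\<lambda>t. (germ h t / t powr (1 / \<beta>)) powr p) \<in> O[at_right 0](\<lambda>_. 1)"
    by (intro bigoI_tendsto) simp_all
  moreover have "(\<lambda>t. t powr (p / \<beta>)) \<in> o[at_right 0](\<lambda>t. t)"
    using p h by (intro powr_smallo_at_right_0) simp
  ultimately have "(\<lambda>t. (germ h t / t powr (1 / \<beta>)) powr p * t powr (p / \<beta>)) \<in> o[at_right 0](\<lambda>t. 1 * t)"
    by (rule landau_o.big_small_mult)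
  moreover have "\<forall>\<^sub>F t in at_right 0. (germ h t / t powr (1 / \<beta>)) powr p * t powr (p / \<beta>) = germ h t powr p"
    using eventually_at_right_0_pos germ_pos[OF assms(1)]
    by eventually_elim (simp add: powr_divide powr_powr)
  ultimately show ?thesis
    using landau_o.small.in_cong by fastforce
qed

text \<open>The leading term is factored out of the germ. The other factor is 1 plus a power sum
  with positive exponents, whose power is handled by \<open>one_plus_power_Fermat\<close>.\<close>

lemma fermat_power_germ:
  assumes "pos_infinitesimal h" "p \<ge> 0"
  shows "little_oh_poly (\<lambda>t. germ h t powr p)" (is ?A)
    and "fermat_power h p = Fermat (\<lambda>t. germ h t powr p)" (is ?B)
proof -
  obtain b \<beta> bs where h: "inf_terms h = (b, \<beta>) # bs" "b > 0" "\<beta> \<ge> 1"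
    "\<forall>(b', \<beta>')\<in>set bs. \<beta>' \<ge> 1 \<and> \<beta>' < \<beta>"
    using assms(1) by (rule pos_infinitesimalE)
  \<comment> \<open>The quotients by the leading term: \<open>e - 1 / \<beta>\<close> is the
    exponent of \<open>dt (ominus \<beta>' \<beta>)\<close> when
    \<open>e = 1 / \<beta>'\<close>.\<close>
  define ks where "ks = map (\<lambda>(a, e). (1 / b * a, e - 1 / \<beta>)) (recip_exps bs)"
  have ks: "\<forall>(a, e)\<in>set ks. e > 0"
    using recip_exps_greater[OF h(4)] by (force simp: ks_def)
  then have ks0: "\<forall>(a, e)\<in>set ks. e \<ge> 0" by force
  obtain \<gamma> where \<gamma>: "\<gamma> > 0" "powr_sum ks \<in> O[at_right 0](\<lambda>t. t powr \<gamma>)"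
    using powr_sum_bigo_powr[OF ks] by blast
  note opp = one_plus_power_Fermat[OF little_oh_poly_powr_sum[OF ks0] \<gamma>(2,1), of p]
  have germ_eq: "germ h t = b * t powr (1 / \<beta>) * (1 + powr_sum ks t)" if "t > 0" for t
    using that h(2) unfolding ks_def powr_sum_shift[OF that]
    by (simp add: germ_def h(1) recip_exps_def distrib_left)
  define q where "q = (\<lambda>t. b powr p * t powr (p / \<beta>) * (1 + powr_sum ks t) powr p)"
  have lop: "little_oh_poly (\<lambda>t. b powr p * t powr (p / \<beta>))"
    using assms h by (intro little_oh_poly_scale little_oh_poly_powr) simp
  have q: "little_oh_poly q"
    unfolding q_def by (intro little_oh_poly_mult lop opp)
  have "\<forall>\<^sub>F t in at_right 0. germ h t powr p = q t"
    using eventually_at_right_0_pos germ_pos[OF assms(1)]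
  proof eventually_elim
    case (elim t)
    \<comment> \<open>Positivity of both factors of the germ lets \<open>powr\<close> distribute
      over their product.\<close>
    then have "1 + powr_sum ks t > 0"
      using h(2) by (simp add: germ_eq zero_less_mult_iff mult_less_0_iff)
    then show ?case using h(2) elim by (simp add: germ_eq q_def powr_mult powr_powr)
  qed
  then have o: "(\<lambda>t. germ h t powr p - q t) \<in> o[at_right 0](\<lambda>t. t)"
    by (rule eventually_eq_imp_smallo)
  show ?A by (rule little_oh_poly_cong_smallo[OF q o])
  have "fermat_power h p = Fermat q"
  proof (cases "p = 0")
    case True
    \<comment> \<open>Here the power is 1 by convention, and \<open>q t = 1\<close> for small
      \<open>t > 0\<close> because all its bases are positive.\<close>
    have "Fermat (\<lambda>_. 1) = Fermat q"
      unfolding True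
    proof (rule Fermat_eq_smalloI[OF q] eventually_eq_imp_smallo)+
      show "\<forall>\<^sub>F t in at_right 0. 1 = q t"
        using eventually_at_right_0_pos germ_pos[OF assms(1)]
        by eventually_elim (use h(2) in \<open>simp add: q_def True germ_eq zero_less_mult_iff mult_less_0_iff\<close>)
    qed
    then show ?thesis by (simp add: fermat_power_def True one_fermat.abs_eq)
  next
    case False
    have "(\<Sum>(b', \<beta>')\<leftarrow>bs. (b' / b) *\<^sub>R dt (ominus \<beta>' \<beta>)) = Fermat (powr_sum ks)"
      unfolding Fermat_powr_sum[OF ks0]
      by (simp add: ks_def recip_exps_def o_def case_prod_unfold dt_def ominus_def inverse_eq_divide)
    then have "fermat_power h p = b powr p *\<^sub>R dt (\<beta> / p) * one_plus_power (Fermat (powr_sum ks)) p"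
      using False by (simp add: fermat_power_def h(1))
    also have "\<dots> = Fermat q"
      unfolding q_def opp(2) using assms h lop opp(1)
      by (simp add: dt_def Fermat_scaleR little_oh_poly_powr Fermat_times del: mult_scaleR_left)
    finally show ?thesis .
  qed
  then show ?B by (simp add: Fermat_eq_smalloI[OF q o])
qed

section \<open>Continuity of the iterates and the Taylor formula in the Fermat reals\<close>

lemma C_0_continuous_on:
  assumes "g \<in> C_0 a b" "a > 0"
  shows "continuous_on {a..b} g"
proof -
  obtain p f1 where f1: "continuous_on {a..b} f1" "\<forall>x\<in>{a..b}. g x = x powr p * f1 x"
    using assms(1) by (auto simp: C_0_def)
  from f1(1) have "continuous_on {a..b} (\<lambda>x. x powr p * f1 x)"
    using assms(2) by (intro continuous_intros) auto
  then show ?thesis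
    by (rule continuous_on_eq) (simp add: f1(2))
qed

theorem theorem46:
  fixes \<alpha> a' a b :: real and n :: nat and f :: "real \<Rightarrow> real" and h :: fermat
  assumes "0 \<le> a'" and "a' < a" and "a < b"
    and "0 < \<alpha>" and "\<alpha> \<le> 1"
    and "f \<in> C_inf_alpha \<alpha> a b"
    and "h \<in> D_inf ((real n + 1) * \<alpha> - 1)"
    and "pos_infinitesimal h"
  shows "fermat_value f a h =
    (\<Sum>i=0..n. (1 / Gamma (real i * \<alpha> + 1)) *\<^sub>R fermat_power h (real i * \<alpha>)
              * of_real (caputo_iter a b \<alpha> i f a))"
proof -
  define g where "g = (\<lambda>k. caputo_iter a b \<alpha> k f)"
  have g_Suc: "g (Suc k) = caputo a b \<alpha> (g k)" for k
    by (simp add: g_def caputo_iter_def)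
  have cont: "continuous_on {a..b} (g k)" for k
    using assms(1,2,6) by (intro C_0_continuous_on) (auto simp: C_inf_alpha_def g_def)
  have "((\<lambda>s. (x - s) powr (\<alpha> - 1) * g (Suc k) s) has_integral Gamma \<alpha> * (g k x - g k a)) {a<..<x}"
    if "x \<in> {a<..b}" for x k
    unfolding g_Suc using assms(6)
    by (intro caputo_inversion assms cont that) (auto simp: C_inf_alpha_def g_def)
  \<comment> \<open>The terms \<open>0, ..., n\<close> number \<open>Suc n\<close>, which gives the
    remainder exponent \<open>(n + 1) \<alpha>\<close>.\<close>
  from fractional_Taylor_bound[of a b \<alpha> g, OF assms(3,4) cont this, of 0 "Suc n"]
  obtain C where C: "\<forall>x\<in>{a<..b}.
     \<bar>g 0 x - (\<Sum>i<Suc n. g i a / Gamma (real i * \<alpha> + 1) * (x - a) powr (real i * \<alpha>))\<bar>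
       \<le> C * (x - a) powr (real (Suc n) * \<alpha>)" unfolding add_0 by blast
  have f: "f = g 0" by (simp add: g_def caputo_iter_def)
  define c where "c = (\<lambda>i. g i a / Gamma (real i * \<alpha> + 1))"
  define T where "T = (\<lambda>t. \<Sum>i<Suc n. c i * germ h t powr (real i * \<alpha>))"
  have lop: "little_oh_poly (\<lambda>t. germ h t powr (real i * \<alpha>))" for i
    using assms(4,8) by (intro fermat_power_germ) simp_all
  have lop_T: "little_oh_poly T"
    unfolding T_def by (intro little_oh_poly_sum little_oh_poly_scale lop) simp
  \<comment> \<open>Together with positivity of the germ this keeps \<open>a + germ h t\<close> in
    \<open>{a<..b}\<close>, where the Taylor bound holds.\<close>
  have "\<forall>\<^sub>F t in at_right 0. germ h t < b - a"
    using order_tendstoD(2)[OF germ_tendsto_0[OF assms(8)], of "b - a"] assms(3) by simp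
  with germ_pos[OF assms(8)]
  have "\<forall>\<^sub>F t in at_right 0. norm (f (a + germ h t) - T t) \<le> C * norm (germ h t powr (real (Suc n) * \<alpha>))"
  proof eventually_elim
    case (elim t)
    then have "a + germ h t \<in> {a<..b}" by simp
    with C have "\<bar>g 0 (a + germ h t) - (\<Sum>i<Suc n. g i a / Gamma (real i * \<alpha> + 1) *
        (a + germ h t - a) powr (real i * \<alpha>))\<bar> \<le> C * (a + germ h t - a) powr (real (Suc n) * \<alpha>)"
      by (rule bspec)
    then show ?case
      by (simp add: T_def c_def f del: of_nat_Suc sum.lessThan_Suc)
  qed
  then have "(\<lambda>t. f (a + germ h t) - T t) \<in> O[at_right 0](\<lambda>t. germ h t powr (real (Suc n) * \<alpha>))"
    by (rule bigoI)
  \<comment> \<open>\<open>D_inf\<close> adds 1 to its index, so membership of \<open>h\<close> says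
    exactly that its order is below \<open>(n + 1) \<alpha>\<close>.\<close>
  also have "(\<lambda>t. germ h t powr (real (Suc n) * \<alpha>)) \<in> o[at_right 0](\<lambda>t. t)"
    using assms(7) by (intro germ_powr_smallo assms(8)) (simp add: D_inf_def add.commute)
  finally have "fermat_value f a h = Fermat T"
    unfolding fermat_value_germ by (intro Fermat_eq_smalloI lop_T)
  also have "\<dots> = (\<Sum>i<Suc n. c i *\<^sub>R Fermat (\<lambda>t. germ h t powr (real i * \<alpha>)))"
    unfolding T_def Fermat_scaleR[OF lop] by (intro Fermat_sum[symmetric] little_oh_poly_scale lop) simp
  also have "\<dots> = (\<Sum>i=0..n. (1 / Gamma (real i * \<alpha> + 1)) *\<^sub>R fermat_power h (real i * \<alpha>) * of_real (g i a))"
  proof (rule sum.cong)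
    show "c i *\<^sub>R Fermat (\<lambda>t. germ h t powr (real i * \<alpha>)) =
        (1 / Gamma (real i * \<alpha> + 1)) *\<^sub>R fermat_power h (real i * \<alpha>) * of_real (g i a)" for i
      using assms(4,8) by (simp add: fermat_power_germ(2) c_def of_real_def)
  qed auto
  finally show ?thesis by (simp only: g_def)
qed

end
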